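(* There exists a constant $L>0$ such that the following holds for all sufficiently large $n\in\mathbb{N}$. Let $G$ be the path or the cycle on $\mathbb{Z}_n$, let $\epsilon\in(0,1)$ and let $\rho\in[L(n\epsilon)^{-1/4},1]$. Then there is an $(\epsilon,\rho)$-uniformity tester for $G$ (with error probability at most $1/3$) that uses $O\!\left(\frac{\sqrt n}{\rho\epsilon^2}\right)$ clustered samples and $O(\rho n\log n)$ label queries.
   Context: Throughout, $\log$ is the natural logarithm. Let $G$ be the path on $\mathbb{Z}_n=\{0,\dots,n-1\}$ (edges $\{i,i+1\}$ for $0\le i\le n-2$) or the cycle (additionally the edge $\{n-1,0\}$). For a resolution parameter $\rho\in(0,1]$, a random clustering is generated as follows: each edge of $G$ is deleted independently with probability $\rho$, giving a random subgraph $\boldsymbol H$; the cells of the clustering are the connected components of $\boldsymbol H$, and each cell is assigned a representative chosen uniformly at random from the cell. A tester has access to (i) a clustered-sample oracle, which on each request returns, independently, the representative of the cell containing a point $x\sim\mu$, where $\mu$ is an unknown distribution on $\mathbb{Z}_n$; and (ii) a label oracle, which on query $x$ returns the representative of the cell containing $x$. Let $\nu$ be the uniform distribution on $\mathbb{Z}_n$. An algorithm is an $(\epsilon,\rho)$-uniformity tester for $G$ with error probability $\delta$ if for every distribution $\mu$ on $\mathbb{Z}_n$: if $\mu=\nu$ it accepts with probability at least $1-\delta$, and if $\mathrm{d}_{TV}(\mu,\nu)>\epsilon$ it rejects with probability at least $1-\delta$, where probabilities are over the algorithm's randomness, the oracle responses, and the random clustering. *)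

theory Defs
  imports "HOL-Probability.Probability"
begin

text \<open>
  The vertex set \<open>\<int>\<^sub>n\<close> is \<open>{..<n}\<close>; a graph on it is given by its set of edges, an edge being the
  set of its two endpoints.
\<close>

definition path_edges :: "nat \<Rightarrow> nat set set" where
  "path_edges n = {{i, Suc i} | i. Suc i < n}"

definition cycle_edges :: "nat \<Rightarrow> nat set set" where
  "cycle_edges n = insert {n - 1, 0} (path_edges n)"

text \<open>The connected component of \<open>x\<close> in the graph with vertices \<open>{..<n}\<close> and edges \<open>H\<close>.\<close>

definition cell :: "nat \<Rightarrow> nat set set \<Rightarrow> nat \<Rightarrow> nat set" where
  "cell n H x = {y. y < n \<and> (x, y) \<in> {(u, v). {u, v} \<in> H}\<^sup>*}"

definition cells :: "nat \<Rightarrow> nat set set \<Rightarrow> nat set set" where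
  "cells n H = cell n H ` {..<n}"

text \<open>
  A clustering is represented by its labelling, which maps each point to the representative of its
  cell; this is all that the oracles reveal.
\<close>

definition random_subgraph :: "nat set set \<Rightarrow> real \<Rightarrow> nat set set pmf" where
  "random_subgraph E \<rho> =
     map_pmf (\<lambda>deleted. {e \<in> E. \<not> deleted e}) (Pi_pmf E False (\<lambda>_. bernoulli_pmf \<rho>))"

definition random_labelling :: "nat \<Rightarrow> nat set set \<Rightarrow> (nat \<Rightarrow> nat) pmf" where
  "random_labelling n H =
     map_pmf (\<lambda>rep x. rep (cell n H x)) (Pi_pmf (cells n H) 0 pmf_of_set)"

definition random_clustering :: "nat \<Rightarrow> nat set set \<Rightarrow> real \<Rightarrow> (nat \<Rightarrow> nat) pmf" where
  "random_clustering n E \<rho> = bind_pmf (random_subgraph E \<rho>) (random_labelling n)"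

text \<open>
  Adaptive randomized algorithms with oracle access, as decision trees: \<open>Decide True\<close> accepts,
  \<open>Random p\<close> uses internal randomness, and the continuation of a sample or of a label query takes
  the oracle's answer.
\<close>

datatype algorithm =
    Decide bool
  | Random "algorithm pmf"
  | Sample "nat \<Rightarrow> algorithm"
  | Query nat "nat \<Rightarrow> algorithm"

text \<open>The verdict on unknown distribution \<open>\<mu>\<close>, for a fixed labelling \<open>c\<close>.\<close>

primrec run :: "nat pmf \<Rightarrow> (nat \<Rightarrow> nat) \<Rightarrow> algorithm \<Rightarrow> bool pmf" where
  "run \<mu> c (Decide b) = return_pmf b"
| "run \<mu> c (Random p) = join_pmf (map_pmf (run \<mu> c) p)"
| "run \<mu> c (Sample k) = bind_pmf \<mu> (\<lambda>x. run \<mu> c (k (c x)))"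
| "run \<mu> c (Query x k) = run \<mu> c (k (c x))"

text \<open>
  \<open>uses_at_most n s q a\<close>: on every execution, whatever the internal randomness and the oracle
  answers in \<open>\<int>\<^sub>n\<close>, \<open>a\<close> makes at most \<open>s\<close> sample requests and at most \<open>q\<close> label queries, all of the
  latter at points of \<open>\<int>\<^sub>n\<close>.
\<close>

inductive uses_at_most :: "nat \<Rightarrow> nat \<Rightarrow> nat \<Rightarrow> algorithm \<Rightarrow> bool" for n :: nat where
  Decide: "uses_at_most n s q (Decide b)"
| Random: "(\<And>a. a \<in> set_pmf p \<Longrightarrow> uses_at_most n s q a) \<Longrightarrow> uses_at_most n s q (Random p)"
| Sample: "(\<And>y. y < n \<Longrightarrow> uses_at_most n s q (k y)) \<Longrightarrow> uses_at_most n (Suc s) q (Sample k)"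
| Query: "x < n \<Longrightarrow> (\<And>y. y < n \<Longrightarrow> uses_at_most n s q (k y)) \<Longrightarrow>
    uses_at_most n s (Suc q) (Query x k)"

text \<open>A single clustering is drawn at the start and shared by all oracle calls.\<close>

definition verdict :: "nat \<Rightarrow> nat set set \<Rightarrow> real \<Rightarrow> nat pmf \<Rightarrow> algorithm \<Rightarrow> bool pmf" where
  "verdict n E \<rho> \<mu> a = bind_pmf (random_clustering n E \<rho>) (\<lambda>c. run \<mu> c a)"

definition tv_dist :: "nat \<Rightarrow> nat pmf \<Rightarrow> nat pmf \<Rightarrow> real" where
  "tv_dist n \<mu> \<nu> = (\<Sum>x<n. \<bar>pmf \<mu> x - pmf \<nu> x\<bar>) / 2"

definition uniformity_tester ::
    "nat \<Rightarrow> nat set set \<Rightarrow> real \<Rightarrow> real \<Rightarrow> real \<Rightarrow> algorithm \<Rightarrow> bool" where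
  "uniformity_tester n E \<epsilon> \<rho> \<delta> a \<longleftrightarrow>
     (\<forall>\<mu>. set_pmf \<mu> \<subseteq> {..<n} \<longrightarrow>
        (\<mu> = pmf_of_set {..<n} \<longrightarrow> pmf (verdict n E \<rho> \<mu> a) True \<ge> 1 - \<delta>) \<and>
        (tv_dist n \<mu> (pmf_of_set {..<n}) > \<epsilon> \<longrightarrow> pmf (verdict n E \<rho> \<mu> a) False \<ge> 1 - \<delta>))"

end

theory Submission
  imports Defs
begin

text \<open>
  The tester uses only the cells that consist of a single interior point: for such a point \<open>x\<close> the
  label \<open>x\<close> is returned with probability exactly \<open>\<mu> x\<close>, so no resolution is lost there. The label
  queries learn the whole clustering by bisection, each deleted edge costing \<open>O(log n)\<close> queries, and
  so reveal the set \<open>S\<close> of these points, of size about \<open>\<rho>\<^sup>2 n\<close>. If \<open>\<mu>\<close> is \<open>\<epsilon>\<close>-far from uniform, then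
  \<open>\<mu>\<close> falls short of \<open>1 / n\<close> by more than \<open>\<epsilon>\<close> in total and by at most \<open>1 / n\<close> at each point; by
  Chebyshev, \<open>S\<close> captures a shortfall of order \<open>\<rho>\<^sup>2 \<epsilon>\<close>, and by Cauchy-Schwarz the squared
  \<open>L2\<close> distance on \<open>S\<close> is at least of order \<open>\<rho>\<^sup>2 \<epsilon>\<^sup>2 / n\<close>. A collision statistic between two
  independent batches of samples estimates that distance: its standard deviation under uniformity is
  of order \<open>\<rho> / (m \<cdot> sqrt n)\<close> for batches of size \<open>m\<close>, so \<open>m\<close> of order \<open>sqrt n / (\<rho> \<epsilon>\<^sup>2)\<close> suffices.
\<close>

section \<open>Cells of random subgraphs of the path and the cycle\<close>

text \<open>Each single step stays inside the block: an edge \<open>{k, Suc k}\<close> crosses its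
  boundary only for \<open>k = i\<close> or \<open>k = j\<close>, and the wrap-around edge
  \<open>{n - 1, 0}\<close> does not touch it, because the block lies above \<open>i\<close> and
  ends before \<open>n - 1\<close>.\<close>

lemma barrier_rtrancl:
  assumes H: "H \<subseteq> cycle_edges n"
    and i: "{i, Suc i} \<notin> H" and j: "{j, Suc j} \<notin> H" and jn: "Suc j < n"
    and xy: "(x, y) \<in> {(u, v). {u, v} \<in> H}\<^sup>*"
    and x: "x \<in> {i<..j}"
  shows "y \<in> {i<..j}"
  using xy x
proof (induction rule: rtrancl_induct)
  case (step y z)
  then have y: "y \<in> {i<..j}" and yz: "{y, z} \<in> H" by auto
  from yz H have "{y, z} = {n - 1, 0} \<or> (\<exists>k. {y, z} = {k, Suc k})"
    unfolding cycle_edges_def path_edges_def by blast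
  then show ?case
  proof
    assume "{y, z} = {n - 1, 0}"
    with y jn show ?thesis by (auto simp: doubleton_eq_iff)
  next
    assume "\<exists>k. {y, z} = {k, Suc k}"
    then obtain k where k: "{y, z} = {k, Suc k}" by blast
    then have "k \<noteq> i" "k \<noteq> j" using yz i j by metis+
    with k y show ?thesis by (auto simp: doubleton_eq_iff)
  qed
qed

lemma rtrancl_edges_sym:
  "(x, y) \<in> {(u, v). {u, v} \<in> H}\<^sup>* \<Longrightarrow> (y, x) \<in> {(u, v). {u, v} \<in> H}\<^sup>*"
  by (rule symD[OF sym_rtrancl]) (auto simp: sym_def insert_commute)

section \<open>What the labels reveal about connectivity\<close>

lemma
  assumes c: "c \<in> set_pmf (random_labelling n H)"
  shows random_labelling_in_cell: "x < n \<Longrightarrow> c x \<in> cell n H x"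
    and random_labelling_eq:
      "(x, y) \<in> {(u, v). {u, v} \<in> H}\<^sup>* \<Longrightarrow> c x = c y"
proof -
  let ?R = "{(u, v). {u, v} \<in> H}\<^sup>*"
  have fin: "finite (cells n H)" unfolding cells_def by simp
  from c obtain rep where rep: "rep \<in> set_pmf (Pi_pmf (cells n H) 0 pmf_of_set)"
    and cr: "c = (\<lambda>x. rep (cell n H x))"
    unfolding random_labelling_def by auto
  show "c x \<in> cell n H x" if "x < n"
  proof -
    have C: "cell n H x \<in> cells n H" using that unfolding cells_def by auto
    with rep have "rep (cell n H x) \<in> set_pmf (pmf_of_set (cell n H x))"
      by (auto simp: set_Pi_pmf[OF fin] PiE_dflt_def)
    moreover have "x \<in> cell n H x" "finite (cell n H x)" using that by (auto simp: cell_def)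
    ultimately show ?thesis using cr by (subst (asm) set_pmf_of_set) auto
  qed
  show "c x = c y" if "(x, y) \<in> ?R"
  proof -
    have "cell n H x = cell n H y"
      unfolding cell_def using that rtrancl_edges_sym[OF that] by (auto intro: rtrancl_trans)
    then show ?thesis using cr by simp
  qed
qed

text \<open>A representative belongs to its own cell, so \<open>x\<close> and \<open>y\<close> are
  both connected to their common label. Distinct cells therefore never share a label.\<close>

lemma random_labelling_eqD:
  assumes c: "c \<in> set_pmf (random_labelling n H)" and "x < n" "y < n" "c x = c y"
  shows "(x, y) \<in> {(u, v). {u, v} \<in> H}\<^sup>*"
proof -
  have "(x, c x) \<in> {(u, v). {u, v} \<in> H}\<^sup>*" "(y, c x) \<in> {(u, v). {u, v} \<in> H}\<^sup>*"
    using random_labelling_in_cell[OF c] assms unfolding cell_def by force+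
  then show ?thesis using rtrancl_edges_sym rtrancl_trans by fast
qed

text \<open>The form of the set that can be computed from labels; \<open>isolated\<close> is the
  same set seen from the subgraph, where its distribution is accessible. Leaving out
  \<open>0\<close> and \<open>n - 1\<close> makes the path and the cycle behave alike.\<close>

definition singletons :: "nat \<Rightarrow> (nat \<Rightarrow> nat) \<Rightarrow> nat set" where
  "singletons n c = {x. 0 < x \<and> Suc x < n \<and> c (x - 1) \<noteq> c x \<and> c x \<noteq> c (Suc x)}"

definition isolated :: "nat \<Rightarrow> nat set set \<Rightarrow> nat set" where
  "isolated n H = {x. 0 < x \<and> Suc x < n \<and> {x - 1, x} \<notin> H \<and> {x, Suc x} \<notin> H}"

lemma finite_isolated [simp]: "finite (isolated n H)"
  by (rule finite_subset[of _ "{..<n}"]) (auto simp: isolated_def)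

lemma jump_edge:
  assumes c: "c \<in> set_pmf (random_labelling n H)" and "c x \<noteq> c (Suc x)"
  shows "{x, Suc x} \<notin> H"
  using random_labelling_eq[OF c, of x "Suc x"] assms(2) by auto

text \<open>The cell of \<open>x\<close> is \<open>{x}\<close>, so its representative must be
  \<open>x\<close>, and any other point labelled \<open>x\<close> would lie in that cell. This is
  why samples keep full resolution at isolated points.\<close>

lemma isolated_label:
  assumes c: "c \<in> set_pmf (random_labelling n H)" and H: "H \<subseteq> cycle_edges n"
    and x: "x \<in> isolated n H" and y: "y < n"
  shows "c y = x \<longleftrightarrow> y = x"
proof -
  from x have x': "0 < x" "Suc x < n" "{x - 1, Suc (x - 1)} \<notin> H" "{x, Suc x} \<notin> H"
    unfolding isolated_def by auto
  \<comment> \<open>The two missing edges enclose the block \<open>{x - 1<..x}\<close>, which is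
    just \<open>{x}\<close>.\<close>
  have only: "z = x" if "(x, z) \<in> {(u, v). {u, v} \<in> H}\<^sup>*" for z
    using barrier_rtrancl[OF H x'(3,4,2) that] x'(1) by auto
  have "c x = x"
    using random_labelling_in_cell[OF c, of x] x'(2) only unfolding cell_def by auto
  moreover have "y = x" if "c y = x"
    using only[OF random_labelling_eqD[OF c, of x y]] that x' y \<open>c x = x\<close> by auto
  ultimately show ?thesis by auto
qed

lemma singletons_eq_isolated:
  assumes c: "c \<in> set_pmf (random_labelling n H)" and H: "H \<subseteq> cycle_edges n"
  shows "singletons n c = isolated n H"
proof (intro set_eqI iffI)
  fix x assume "x \<in> singletons n c"
  then show "x \<in> isolated n H"
    using jump_edge[OF c, of "x - 1"] jump_edge[OF c, of x]
    unfolding singletons_def isolated_def by auto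
next
  fix x assume x: "x \<in> isolated n H"
  then have "0 < x" "Suc x < n" unfolding isolated_def by auto
  then show "x \<in> singletons n c"
    using isolated_label[OF c H x, of x] isolated_label[OF c H x, of "x - 1"]
      isolated_label[OF c H x, of "Suc x"]
    unfolding singletons_def by auto
qed

section \<open>Intervals on which equal end labels force constancy\<close>

lemma segment_rtrancl:
  assumes "lo \<le> hi" and "\<And>i. lo \<le> i \<Longrightarrow> i < hi \<Longrightarrow> {i, Suc i} \<in> H"
  shows "(lo, hi) \<in> {(u, v). {u, v} \<in> H}\<^sup>*"
  using assms
proof (induction hi rule: dec_induct)
  case (step m)
  then have "(lo, m) \<in> {(u, v). {u, v} \<in> H}\<^sup>*" "(m, Suc m) \<in> {(u, v). {u, v} \<in> H}" by auto
  then show ?case by (rule rtrancl_into_rtrancl)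
qed simp

text \<open>The soundness condition for bisection: once the end labels of an interval agree, nothing
  inside it remains to be asked.\<close>

definition no_return :: "(nat \<Rightarrow> nat) \<Rightarrow> nat \<Rightarrow> nat \<Rightarrow> bool" where
  "no_return c lo hi \<longleftrightarrow>
     (\<forall>u v x. lo \<le> u \<longrightarrow> u \<le> x \<longrightarrow> x \<le> v \<longrightarrow> v \<le> hi \<longrightarrow> c u = c v \<longrightarrow> c x = c u)"

lemma no_returnD:
  "no_return c lo hi \<Longrightarrow> c u = c v \<Longrightarrow> lo \<le> u \<Longrightarrow> u \<le> x \<Longrightarrow> x \<le> v \<Longrightarrow> v \<le> hi \<Longrightarrow> c x = c u"
  unfolding no_return_def by blast

text \<open>On the cycle a cell could reach from \<open>u\<close> to \<open>v\<close> the other way round; an edge missing outside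
  \<open>{lo..hi}\<close> rules this out.\<close>

lemma no_return_if_outside_deleted:
  assumes c: "c \<in> set_pmf (random_labelling n H)" and H: "H \<subseteq> cycle_edges n"
    and hi: "hi < n" and j: "{j, Suc j} \<notin> H" "Suc j < n" "j < lo \<or> hi \<le> j"
  shows "no_return c lo hi"
  unfolding no_return_def
proof (intro allI impI)
  fix u v x assume *: "lo \<le> u" "u \<le> x" "x \<le> v" "v \<le> hi" "c u = c v"
  have uv: "(u, v) \<in> {(u, v). {u, v} \<in> H}\<^sup>*"
    using random_labelling_eqD[OF c, of u v] * hi by auto
  have kept: "{i, Suc i} \<in> H" if i: "u \<le> i" "i < v" for i
  proof (rule ccontr)
    assume ni: "{i, Suc i} \<notin> H"
    have "Suc i < n" using i * hi by auto
    \<comment> \<open>The missing edges at \<open>i\<close> and \<open>j\<close> enclose a block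
      that holds exactly one of \<open>u\<close> and \<open>v\<close>: either \<open>{j<..i}\<close>
      holds \<open>u\<close>, or \<open>{i<..j}\<close> holds \<open>v\<close>.\<close>
    show False
    proof (cases "j < lo")
      case True
      then show False
        using barrier_rtrancl[OF H j(1) ni \<open>Suc i < n\<close> uv] i * by auto
    next
      case False
      then show False
        using barrier_rtrancl[OF H ni j(1,2) rtrancl_edges_sym[OF uv]] i * j(3) by auto
    qed
  qed
  have "(u, x) \<in> {(u, v). {u, v} \<in> H}\<^sup>*"
    by (rule segment_rtrancl) (use * kept in auto)
  then show "c x = c u" using random_labelling_eq[OF c] by metis
qed

section \<open>Learning the clustering by bisection\<close>

text \<open>Written in continuation-passing style: \<open>k\<close> receives the completed table and
  the remaining fuel. Fuel is needed because the query bound must hold even for answers that no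
  clustering produces; the verdict on exhaustion is arbitrary. The depth \<open>d\<close> is meant
  for intervals of length at most \<open>2 ^ d\<close>.\<close>

fun bisect :: "nat \<Rightarrow> nat \<Rightarrow> nat \<Rightarrow> (nat \<Rightarrow> nat) \<Rightarrow> nat
    \<Rightarrow> ((nat \<Rightarrow> nat) \<Rightarrow> nat \<Rightarrow> algorithm) \<Rightarrow> algorithm" where
  "bisect 0 lo hi g fuel k = k g fuel"
| "bisect (Suc d) lo hi g fuel k =
     (if g lo = g hi then k (\<lambda>x. if x \<in> {lo..hi} then g lo else g x) fuel
      else case fuel of 0 \<Rightarrow> Decide True
        | Suc f \<Rightarrow> (let mid = (lo + hi) div 2 in
            Query mid (\<lambda>y. bisect d lo mid (g(mid := y)) f
              (\<lambda>g' f'. bisect d mid hi g' f' k))))"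

definition jumps :: "(nat \<Rightarrow> nat) \<Rightarrow> nat \<Rightarrow> nat \<Rightarrow> nat" where
  "jumps c lo hi = card {i \<in> {lo..<hi}. c i \<noteq> c (Suc i)}"

lemma jumps_split: "lo \<le> mid \<Longrightarrow> mid \<le> hi \<Longrightarrow> jumps c lo hi = jumps c lo mid + jumps c mid hi"
  unfolding jumps_def
  by (subst card_Un_disjoint[symmetric]) (auto intro!: arg_cong[where f = card])

lemma jumps_pos:
  assumes "lo \<le> hi" "c lo \<noteq> c hi"
  shows "jumps c lo hi \<ge> 1"
proof (rule ccontr)
  assume "\<not> ?thesis"
  then have *: "c i = c (Suc i)" if "lo \<le> i" "i < hi" for i
    using that unfolding jumps_def by (auto simp: Suc_le_eq card_gt_0_iff)
  have "c lo = c hi" using assms(1) *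
    by (induction hi rule: dec_induct) auto
  with assms(2) show False by simp
qed

text \<open>Every query burns one unit of fuel and the continuation may spend only what is left, so
  the initial fuel bounds the queries of the whole algorithm, whatever the answers.\<close>

lemma uses_at_most_bisect:
  assumes "\<And>g f. uses_at_most n s f (k g f)" and "lo \<le> hi" "hi < n"
  shows "uses_at_most n s fuel (bisect d lo hi g fuel k)"
  using assms
proof (induction d arbitrary: lo hi g fuel k)
  case (Suc d)
  show ?case
  proof (cases "g lo = g hi")
    case False
    show ?thesis
    proof (cases fuel)
      case 0
      then show ?thesis using False by (simp add: uses_at_most.Decide)
    next
      case [simp]: (Suc f)
      show ?thesis using False Suc.prems
        by (auto simp: Let_def intro!: uses_at_most.Query Suc.IH)
    qed
  qed (use Suc.prems in simp)
qed simp

text \<open>An interval is split only if it contains a jump, and on each of the \<open>d\<close>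
  levels a jump lies in at most one interval; hence at most \<open>d\<close> queries per jump. A
  lower bound on the leftover fuel \<open>f'\<close> is what the second half of a split
  needs.\<close>

lemma run_bisect:
  assumes "lo \<le> hi" "hi \<le> lo + 2 ^ d" "g lo = c lo" "g hi = c hi" "no_return c lo hi"
    and "d * jumps c lo hi \<le> fuel"
  shows "\<exists>f' \<ge> fuel - d * jumps c lo hi. run \<mu> c (bisect d lo hi g fuel k) =
           run \<mu> c (k (\<lambda>x. if x \<in> {lo..hi} then c x else g x) f')"
  using assms
proof (induction d arbitrary: lo hi g fuel k)
  case 0
  \<comment> \<open>At depth 0 the interval consists of its end points, whose labels the table
    already holds.\<close>
  then have "hi = lo \<or> hi = Suc lo" by auto
  with 0 have "(\<lambda>x. if x \<in> {lo..hi} then c x else g x) = g" by (auto simp: fun_eq_iff le_Suc_eq)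
  then show ?case by auto
next
  case (Suc d)
  show ?case
  proof (cases "g lo = g hi")
    case True
    then have const: "g lo = c x" if "lo \<le> x" "x \<le> hi" for x
      using no_returnD[OF Suc.prems(5), of lo hi x] Suc.prems(3,4) True that by simp
    have "(\<lambda>x. if x \<in> {lo..hi} then g lo else g x) = (\<lambda>x. if x \<in> {lo..hi} then c x else g x)"
      by (rule ext) (simp add: const)
    then have "run \<mu> c (bisect (Suc d) lo hi g fuel k) =
        run \<mu> c (k (\<lambda>x. if x \<in> {lo..hi} then c x else g x) fuel)"
      using True by (simp only: bisect.simps if_True simp_thms)
    then show ?thesis using diff_le_self by blast
  next
    case False
    define mid where "mid = (lo + hi) div 2"
    have mid: "lo \<le> mid" "mid \<le> hi" "mid \<le> lo + 2 ^ d" "hi \<le> mid + 2 ^ d"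
      using Suc.prems(1,2) unfolding mid_def by auto
    define J1 J2 where "J1 = jumps c lo mid" and "J2 = jumps c mid hi"
    have J: "jumps c lo hi = J1 + J2" unfolding J1_def J2_def using mid by (rule_tac jumps_split)
    \<comment> \<open>The midpoint query is paid for by the growth of the factor from
      \<open>d\<close> to \<open>Suc d\<close>, which is worth \<open>J1 + J2 \<ge> 1\<close>
      units.\<close>
    have "J1 + J2 \<ge> 1" using jumps_pos[of lo hi c] False Suc.prems J by auto
    then have cost: "Suc d * jumps c lo hi \<ge> 1 + d * J1 + d * J2"
      unfolding J by (auto simp: algebra_simps)
    then obtain f where f: "fuel = Suc f" using Suc.prems(6) by (cases fuel) auto
    have nr: "no_return c lo mid" "no_return c mid hi"
      using Suc.prems(5) mid unfolding no_return_def by (meson order_trans)+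
    let ?g1 = "g(mid := c mid)"
    let ?g2 = "\<lambda>x. if x \<in> {lo..mid} then c x else ?g1 x"
    let ?k = "\<lambda>g' f'. bisect d mid hi g' f' k"
    have "d * J1 \<le> f" using cost f Suc.prems(6) by linarith
    moreover have "?g1 lo = c lo" "?g1 mid = c mid" using Suc.prems by auto
    ultimately obtain f1 where f1: "f1 \<ge> f - d * J1"
      and r1: "run \<mu> c (bisect d lo mid ?g1 f ?k) = run \<mu> c (bisect d mid hi ?g2 f1 k)"
      unfolding J1_def using Suc.IH[of lo mid ?g1 f ?k] mid nr by blast
    have "d * J2 \<le> f1" using cost f Suc.prems(6) f1 by linarith
    moreover have g2m: "?g2 mid = c mid" "?g2 hi = c hi" using Suc.prems mid by auto
    ultimately obtain f2 where f2: "f2 \<ge> f1 - d * J2"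
      and r2: "run \<mu> c (bisect d mid hi ?g2 f1 k) =
          run \<mu> c (k (\<lambda>x. if x \<in> {mid..hi} then c x else ?g2 x) f2)"
      unfolding J2_def using Suc.IH[of mid hi ?g2 f1 k] mid nr g2m by blast
    have "(\<lambda>x. if x \<in> {mid..hi} then c x else ?g2 x) = (\<lambda>x. if x \<in> {lo..hi} then c x else g x)"
      using mid by (auto simp: fun_eq_iff)
    moreover have "f2 \<ge> fuel - Suc d * jumps c lo hi"
      using f f1 f2 cost by linarith
    ultimately show ?thesis
      using False f r1 r2 by (intro exI[of _ f2]) (simp add: Let_def mid_def)
  qed
qed

text \<open>Splitting \<open>{..<n}\<close> at the start makes every interval that is searched avoid one half of the
  graph.\<close>

definition learn :: "nat \<Rightarrow> nat \<Rightarrow> nat \<Rightarrow> ((nat \<Rightarrow> nat) \<Rightarrow> algorithm) \<Rightarrow> algorithm" where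
  "learn n d fuel k =
     Query 0 (\<lambda>y0. Query (n div 2) (\<lambda>y1. Query (n - 1) (\<lambda>y2.
       bisect d 0 (n div 2) ((\<lambda>_. 0)(0 := y0, n div 2 := y1, n - 1 := y2)) fuel
         (\<lambda>g f. bisect d (n div 2) (n - 1) g f (\<lambda>g _. k g)))))"

lemma uses_at_most_learn:
  assumes "\<And>g f. uses_at_most n s f (k g)" and "2 \<le> n"
  shows "uses_at_most n s (Suc (Suc (Suc fuel))) (learn n d fuel k)"
  unfolding learn_def using assms
  by (intro uses_at_most.Query uses_at_most_bisect) auto

lemma run_learn:
  assumes n: "3 \<le> n" "n \<le> 2 ^ d"
    and nr: "no_return c 0 (n div 2)" "no_return c (n div 2) (n - 1)"
    and fuel: "d * jumps c 0 (n - 1) \<le> fuel"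
  shows "run \<mu> c (learn n d fuel k) = run \<mu> c (k (\<lambda>x. if x < n then c x else 0))"
proof -
  let ?h = "n div 2"
  define g where "g = (\<lambda>_. 0::nat)(0 := c 0, ?h := c ?h, n - 1 := c (n - 1))"
  define k' where "k' = (\<lambda>g f. bisect d ?h (n - 1) g f (\<lambda>g _. k g))"
  have h: "0 < ?h" "?h < n - 1" using n by auto
  have J: "jumps c 0 (n - 1) = jumps c 0 ?h + jumps c ?h (n - 1)"
    using h by (intro jumps_split) auto
  then have fuel': "d * jumps c 0 ?h + d * jumps c ?h (n - 1) \<le> fuel"
    using fuel by (simp add: algebra_simps)
  have hd: "?h \<le> 2 ^ d" using n by linarith
  let ?g1 = "\<lambda>x. if x \<in> {0..?h} then c x else g x"
  obtain f1 where f1: "f1 \<ge> fuel - d * jumps c 0 ?h"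
    and r1: "run \<mu> c (bisect d 0 ?h g fuel k') = run \<mu> c (k' ?g1 f1)"
    using run_bisect[of 0 ?h d g c fuel \<mu> k'] h n(1) nr fuel' hd by (auto simp: g_def)
  have "n - 1 \<le> ?h + 2 ^ d" "d * jumps c ?h (n - 1) \<le> f1" "?g1 (n - 1) = c (n - 1)"
    using n fuel' f1 by (auto simp: g_def)
  then have "run \<mu> c (k' ?g1 f1) = run \<mu> c (k (\<lambda>x. if x \<in> {?h..n - 1} then c x else ?g1 x))"
    unfolding k'_def
    using run_bisect[of ?h "n - 1" d ?g1 c f1 \<mu> "\<lambda>g _. k g"] h nr
    by auto
  \<comment> \<open>The two intervals overlap in \<open>n div 2\<close> and cover all points below
    \<open>n\<close>; beyond them the initial default 0 survives.\<close>
  also have "(\<lambda>x. if x \<in> {?h..n - 1} then c x else ?g1 x) = (\<lambda>x. if x < n then c x else 0)"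
    using h by (auto simp: fun_eq_iff g_def)
  finally show ?thesis using r1 unfolding learn_def g_def k'_def by simp
qed

section \<open>Drawing samples\<close>

primrec draw :: "nat \<Rightarrow> (nat list \<Rightarrow> algorithm) \<Rightarrow> algorithm" where
  "draw 0 k = k []"
| "draw (Suc m) k = Sample (\<lambda>y. draw m (\<lambda>ys. k (y # ys)))"

lemma uses_at_most_draw:
  "(\<And>ys. uses_at_most n s q (k ys)) \<Longrightarrow> uses_at_most n (m + s) q (draw m k)"
  by (induction m arbitrary: k) (auto intro: uses_at_most.Sample)

text \<open>For a fixed labelling the sample answers are independent draws from the push-forward of
  \<open>\<mu>\<close> under \<open>c\<close>.\<close>

lemma run_draw:
  "run \<mu> c (draw m k) = bind_pmf (replicate_pmf m (map_pmf c \<mu>)) (\<lambda>ys. run \<mu> c (k ys))"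
  by (induction m arbitrary: k)
    (simp_all add: bind_return_pmf bind_assoc_pmf bind_map_pmf)

section \<open>Moments of finitely supported random variables\<close>

lemma expectation_bind_pmf_finite:
  fixes h :: "'b \<Rightarrow> real"
  assumes "finite (set_pmf p)" "\<And>x. x \<in> set_pmf p \<Longrightarrow> finite (set_pmf (f x))"
  shows "measure_pmf.expectation (bind_pmf p f) h =
           measure_pmf.expectation p (\<lambda>x. measure_pmf.expectation (f x) h)"
  using assms by (subst pmf_expectation_bind[of "set_pmf p"])
    (auto simp: integral_measure_pmf[of "set_pmf p"])

lemma finite_set_replicate_pmf [simp]:
  "finite (set_pmf p) \<Longrightarrow> finite (set_pmf (replicate_pmf m p))"
  by (simp add: set_replicate_pmf finite_lists_length_eq lists_eq_set)

lemma pmf_bind_ge: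
  assumes "a \<le> measure_pmf.prob p G" "0 \<le> b"
    and "\<And>y. y \<in> set_pmf p \<Longrightarrow> y \<in> G \<Longrightarrow> b \<le> pmf (f y) x"
  shows "a * b \<le> pmf (bind_pmf p f) x"
proof -
  have "a * b \<le> measure_pmf.prob p G * b" using assms by (intro mult_right_mono)
  also have "\<dots> = measure_pmf.expectation p (\<lambda>y. indicator G y * b)" by simp
  also have "\<dots> \<le> measure_pmf.expectation p (\<lambda>y. pmf (f y) x)"
  proof (rule integral_mono_AE)
    show "integrable (measure_pmf p) (\<lambda>y. indicator G y * b)"
      by (intro measure_pmf.integrable_const_bound[where B = b])
        (use assms(2) in \<open>auto split: split_indicator\<close>)
    show "integrable (measure_pmf p) (\<lambda>y. pmf (f y) x)"
      by (intro measure_pmf.integrable_const_bound[where B = 1]) (auto simp: pmf_le_1)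
    show "AE y in measure_pmf p. indicator G y * b \<le> pmf (f y) x"
      using assms(3) by (auto simp: AE_measure_pmf_iff split: split_indicator)
  qed
  finally show ?thesis by (simp add: pmf_bind)
qed

lemma prob_ge_le_expectation:
  fixes u :: "'a \<Rightarrow> real"
  assumes "finite (set_pmf p)" "\<And>y. 0 \<le> u y" "0 < c"
  shows "measure_pmf.prob p {y. c \<le> u y} \<le> measure_pmf.expectation p u / c"
  using integral_Markov_inequality_measure[of "measure_pmf p" u "{}" c] assms
  by (simp add: integrable_measure_pmf_finite)

lemma expectation_square_minus:
  fixes u :: "'a \<Rightarrow> real"
  assumes "finite (set_pmf p)"
  shows "measure_pmf.expectation p (\<lambda>y. (u y - c)\<^sup>2) =
    measure_pmf.expectation p (\<lambda>y. (u y)\<^sup>2) - 2 * c * measure_pmf.expectation p u + c\<^sup>2"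
proof -
  have "(\<lambda>y. (u y - c)\<^sup>2) = (\<lambda>y. (u y)\<^sup>2 - 2 * c * u y + c\<^sup>2)"
    by (simp add: fun_eq_iff power2_diff)
  then show ?thesis by (simp add: integrable_measure_pmf_finite[OF assms])
qed

text \<open>A bias-variance identity, stated around an arbitrary point \<open>t\<close> so that induction applies.\<close>

lemma expectation_replicate_pmf_square:
  fixes u :: "'a \<Rightarrow> real"
  assumes p: "finite (set_pmf p)"
  defines "e \<equiv> measure_pmf.expectation p u"
  defines "v \<equiv> measure_pmf.expectation p (\<lambda>y. (u y)\<^sup>2) - e\<^sup>2"
  shows "measure_pmf.expectation (replicate_pmf m p) (\<lambda>ys. (sum_list (map u ys) - t)\<^sup>2) =
    real m * v + (real m * e - t)\<^sup>2"
proof (induction m arbitrary: t)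
  case (Suc m)
  \<comment> \<open>The first draw is absorbed into the target, which becomes
    \<open>t - u x\<close>.\<close>
  have "measure_pmf.expectation (replicate_pmf (Suc m) p) (\<lambda>ys. (sum_list (map u ys) - t)\<^sup>2) =
      measure_pmf.expectation p (\<lambda>x. measure_pmf.expectation (replicate_pmf m p)
        (\<lambda>ys. (sum_list (map u ys) - (t - u x))\<^sup>2))"
    using p by (simp add: expectation_bind_pmf_finite algebra_simps)
  also have "\<dots> = measure_pmf.expectation p (\<lambda>x. real m * v + (u x - (t - real m * e))\<^sup>2)"
    unfolding Suc.IH by (simp add: algebra_simps)
  also have "\<dots> = real m * v + (v + e\<^sup>2 - 2 * (t - real m * e) * e + (t - real m * e)\<^sup>2)"
    by (simp add: integrable_measure_pmf_finite[OF p] expectation_square_minus[OF p] v_def e_def)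
  finally show ?case by (simp add: algebra_simps power2_eq_square)
qed simp

section \<open>The two-batch collision statistic\<close>

text \<open>The contribution of one sample to a weighted sum of centred counts. The weights
  \<open>a\<close> will be either the centred counts of the other batch or the true deviations of
  \<open>p\<close> from \<open>w\<close>.\<close>

definition deviation :: "nat set \<Rightarrow> real \<Rightarrow> (nat \<Rightarrow> real) \<Rightarrow> nat \<Rightarrow> real" where
  "deviation S w a y = (\<Sum>x\<in>S. a x * (of_bool (y = x) - w))"

lemma expectation_of_bool_eq:
  "measure_pmf.expectation p (\<lambda>y. of_bool (y = x)) = pmf p x"
  by (subst integral_measure_pmf[of "{x}"]) auto

lemma expectation_deviation:
  assumes p: "finite (set_pmf p)" and S: "finite S"
  shows "measure_pmf.expectation p (deviation S w a) = (\<Sum>x\<in>S. a x * (pmf p x - w))"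
  unfolding deviation_def
  by (simp add: integrable_measure_pmf_finite[OF p] expectation_of_bool_eq)

text \<open>Centring by a constant does not change the variance, and the uncentred variable equals
  \<open>a y\<close> on \<open>S\<close> and 0 elsewhere; its second moment is the right-hand
  side.\<close>

lemma variance_deviation_le:
  assumes p: "finite (set_pmf p)" and S: "finite S"
  shows "measure_pmf.expectation p (\<lambda>y. (deviation S w a y)\<^sup>2)
      - (measure_pmf.expectation p (deviation S w a))\<^sup>2 \<le> (\<Sum>x\<in>S. (a x)\<^sup>2 * pmf p x)"
proof -
  define g where "g y = (\<Sum>x\<in>S. a x * of_bool (y = x))" for y
  define k where "k = w * (\<Sum>x\<in>S. a x)"
  have dev: "deviation S w a = (\<lambda>y. g y - k)"
    by (simp add: fun_eq_iff deviation_def g_def k_def sum_distrib_left sum_subtractf algebra_simps)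
  have g: "g y = (if y \<in> S then a y else 0)" for y
  proof -
    have "g y = (\<Sum>x\<in>S. if x = y then a x else 0)" unfolding g_def by (intro sum.cong) auto
    then show ?thesis using S by simp
  qed
  then have g2: "(g y)\<^sup>2 = (\<Sum>x\<in>S. (a x)\<^sup>2 * of_bool (y = x))" for y
  proof -
    have "(\<Sum>x\<in>S. (a x)\<^sup>2 * of_bool (y = x)) = (\<Sum>x\<in>S. if x = y then (a x)\<^sup>2 else 0)"
      by (intro sum.cong) auto
    then show ?thesis using S g by simp
  qed
  have "measure_pmf.expectation p (\<lambda>y. (g y)\<^sup>2) = (\<Sum>x\<in>S. (a x)\<^sup>2 * pmf p x)"
    unfolding g2 by (simp add: integrable_measure_pmf_finite[OF p] expectation_of_bool_eq)
  moreover have E: "measure_pmf.expectation p (\<lambda>y. g y - k) = measure_pmf.expectation p g - k"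
    by (simp add: integrable_measure_pmf_finite[OF p])
  ultimately show ?thesis
    unfolding dev expectation_square_minus[OF p] E by (simp add: power2_diff)
qed

definition batch_dev :: "real \<Rightarrow> nat list \<Rightarrow> nat \<Rightarrow> real" where
  "batch_dev w ys x = sum_list (map (\<lambda>y. of_bool (y = x) - w) ys)"

text \<open>Multiplying centred counts of two independent batches avoids the diagonal terms of a
  square, so the mean is exactly \<open>m^2\<close> times the squared L2 distance from
  \<open>w\<close> on \<open>S\<close>.\<close>

definition collision_stat :: "nat set \<Rightarrow> real \<Rightarrow> nat list \<Rightarrow> nat list \<Rightarrow> real" where
  "collision_stat S w ys zs = (\<Sum>x\<in>S. batch_dev w ys x * batch_dev w zs x)"

text \<open>With the first batch fixed, the statistic is a sum of independent terms over the second
  one.\<close>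

lemma collision_stat_eq:
  "collision_stat S w ys zs = sum_list (map (deviation S w (batch_dev w ys)) zs)"
  by (induction zs)
    (simp_all add: collision_stat_def batch_dev_def deviation_def sum.distrib distrib_left)

lemma sum_batch_dev:
  "(\<Sum>x\<in>S. a x * batch_dev w ys x) = sum_list (map (deviation S w a) ys)"
  by (induction ys) (simp_all add: batch_dev_def deviation_def sum.distrib distrib_left)

lemma expectation_batch_dev_square_le:
  assumes p: "finite (set_pmf p)"
  shows "measure_pmf.expectation (replicate_pmf m p) (\<lambda>ys. (batch_dev w ys x)\<^sup>2)
    \<le> real m * pmf p x + (real m)\<^sup>2 * (pmf p x - w)\<^sup>2"
proof -
  have d: "(\<lambda>y. of_bool (y = x) - w) = deviation {x} w (\<lambda>_. 1)"
    by (simp add: fun_eq_iff deviation_def)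
  have "measure_pmf.expectation (replicate_pmf m p) (\<lambda>ys. (batch_dev w ys x)\<^sup>2) =
      real m * (measure_pmf.expectation p (\<lambda>y. (deviation {x} w (\<lambda>_. 1) y)\<^sup>2)
        - (measure_pmf.expectation p (deviation {x} w (\<lambda>_. 1)))\<^sup>2)
      + (real m * (pmf p x - w))\<^sup>2"
    using expectation_replicate_pmf_square[OF p, where t = 0] unfolding batch_dev_def d
    by (simp add: expectation_deviation p)
  also have "\<dots> \<le> real m * pmf p x + (real m * (pmf p x - w))\<^sup>2"
    using variance_deviation_le[OF p, of "{x}" w "\<lambda>_. 1"]
    by (intro add_right_mono mult_left_mono) auto
  finally show ?thesis by (simp add: power_mult_distrib)
qed

text \<open>The bias-variance identity is applied first to \<open>zs\<close> with \<open>ys\<close>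
  fixed, then to \<open>ys\<close>. The cubic term arises twice: from the squared means of the
  counts in the first batch, and from the fluctuation of the conditional mean given
  \<open>ys\<close>.\<close>

lemma collision_stat_variance:
  fixes w :: real and m :: nat
  assumes p: "finite (set_pmf p)" and S: "finite S"
  defines "f \<equiv> \<lambda>x. pmf p x - w"
  defines "R \<equiv> replicate_pmf m p"
  shows "measure_pmf.expectation (pair_pmf R R)
      (\<lambda>(ys, zs). (collision_stat S w ys zs - (real m)\<^sup>2 * (\<Sum>x\<in>S. (f x)\<^sup>2))\<^sup>2)
    \<le> (real m)\<^sup>2 * (\<Sum>x\<in>S. (pmf p x)\<^sup>2) + 2 * (real m)^3 * (\<Sum>x\<in>S. (f x)\<^sup>2 * pmf p x)"
proof -
  define T where "T = (\<Sum>x\<in>S. (f x)\<^sup>2)"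
  have R: "finite (set_pmf R)" unfolding R_def using p by simp
  note int = integrable_measure_pmf_finite[OF R]
  have "measure_pmf.expectation (pair_pmf R R)
        (\<lambda>(ys, zs). (collision_stat S w ys zs - (real m)\<^sup>2 * T)\<^sup>2) =
      measure_pmf.expectation R (\<lambda>ys. measure_pmf.expectation R
        (\<lambda>zs. (collision_stat S w ys zs - (real m)\<^sup>2 * T)\<^sup>2))"
    unfolding pair_pmf_def using R by (simp add: expectation_bind_pmf_finite)
  also have "\<dots> \<le> measure_pmf.expectation R (\<lambda>ys.
      real m * (\<Sum>x\<in>S. (batch_dev w ys x)\<^sup>2 * pmf p x)
      + (real m)\<^sup>2 * (sum_list (map (deviation S w f) ys) - real m * T)\<^sup>2)"
  proof (rule integral_mono[OF int int])
    fix ys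
    let ?a = "batch_dev w ys"
    have "measure_pmf.expectation R (\<lambda>zs. (collision_stat S w ys zs - (real m)\<^sup>2 * T)\<^sup>2) =
        real m * (measure_pmf.expectation p (\<lambda>y. (deviation S w ?a y)\<^sup>2)
          - (measure_pmf.expectation p (deviation S w ?a))\<^sup>2)
        + (real m * (\<Sum>x\<in>S. ?a x * f x) - (real m)\<^sup>2 * T)\<^sup>2"
      unfolding collision_stat_eq R_def expectation_replicate_pmf_square[OF p]
      by (simp add: expectation_deviation p S f_def)
    also have "\<dots> \<le> real m * (\<Sum>x\<in>S. (?a x)\<^sup>2 * pmf p x)
        + (real m * (\<Sum>x\<in>S. ?a x * f x) - (real m)\<^sup>2 * T)\<^sup>2"
      using variance_deviation_le[OF p S, of w ?a] by (intro add_right_mono mult_left_mono) auto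
    also have "(\<Sum>x\<in>S. ?a x * f x) = sum_list (map (deviation S w f) ys)"
      by (simp add: sum_batch_dev[symmetric] mult.commute)
    also have "(real m * sum_list (map (deviation S w f) ys) - (real m)\<^sup>2 * T)\<^sup>2 =
        (real m)\<^sup>2 * (sum_list (map (deviation S w f) ys) - real m * T)\<^sup>2"
      by (simp add: power2_eq_square algebra_simps)
    finally show "measure_pmf.expectation R (\<lambda>zs. (collision_stat S w ys zs - (real m)\<^sup>2 * T)\<^sup>2) \<le>
      real m * (\<Sum>x\<in>S. (batch_dev w ys x)\<^sup>2 * pmf p x)
      + (real m)\<^sup>2 * (sum_list (map (deviation S w f) ys) - real m * T)\<^sup>2" .
  qed
  also have "\<dots> = real m * (\<Sum>x\<in>S. measure_pmf.expectation R (\<lambda>ys. (batch_dev w ys x)\<^sup>2) * pmf p x)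
      + (real m)\<^sup>2 * measure_pmf.expectation R
          (\<lambda>ys. (sum_list (map (deviation S w f) ys) - real m * T)\<^sup>2)"
    by (simp add: int)
  also have "\<dots> \<le> real m * (\<Sum>x\<in>S. (real m * pmf p x + (real m)\<^sup>2 * (f x)\<^sup>2) * pmf p x)
      + (real m)\<^sup>2 * (real m * (\<Sum>x\<in>S. (f x)\<^sup>2 * pmf p x))"
  proof (intro add_mono mult_left_mono sum_mono mult_right_mono)
    show "measure_pmf.expectation R (\<lambda>ys. (batch_dev w ys x)\<^sup>2)
        \<le> real m * pmf p x + (real m)\<^sup>2 * (f x)\<^sup>2" for x
      unfolding R_def f_def by (rule expectation_batch_dev_square_le[OF p])
    have "measure_pmf.expectation p (deviation S w f) = T"
      by (simp add: expectation_deviation p S T_def f_def power2_eq_square)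
    then show "measure_pmf.expectation R
        (\<lambda>ys. (sum_list (map (deviation S w f) ys) - real m * T)\<^sup>2)
        \<le> real m * (\<Sum>x\<in>S. (f x)\<^sup>2 * pmf p x)"
      using variance_deviation_le[OF p S, of w f]
      unfolding R_def expectation_replicate_pmf_square[OF p] by (simp add: mult_left_mono)
  qed auto
  also have "\<dots> = (real m)\<^sup>2 * (\<Sum>x\<in>S. (pmf p x)\<^sup>2) + 2 * (real m)^3 * (\<Sum>x\<in>S. (f x)\<^sup>2 * pmf p x)"
    by (simp add: sum.distrib sum_distrib_left distrib_left distrib_right power2_eq_square
        power3_eq_cube mult_ac)
  finally show ?thesis unfolding T_def .
qed

lemma collision_stat_concentration:
  fixes w :: real and m :: nat
  assumes p: "finite (set_pmf p)" and S: "finite S" and r: "0 < r"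
  defines "f \<equiv> \<lambda>x. pmf p x - w"
  defines "R \<equiv> replicate_pmf m p"
  shows "measure_pmf.prob (pair_pmf R R)
      {(ys, zs). r \<le> \<bar>collision_stat S w ys zs - (real m)\<^sup>2 * (\<Sum>x\<in>S. (f x)\<^sup>2)\<bar>}
    \<le> ((real m)\<^sup>2 * (\<Sum>x\<in>S. (pmf p x)\<^sup>2) + 2 * (real m)^3 * (\<Sum>x\<in>S. (f x)\<^sup>2 * pmf p x)) / r\<^sup>2"
proof -
  define u where "u = (\<lambda>(ys, zs). (collision_stat S w ys zs - (real m)\<^sup>2 * (\<Sum>x\<in>S. (f x)\<^sup>2))\<^sup>2)"
  have R: "finite (set_pmf (pair_pmf R R))" unfolding R_def using p by simp
  have "r \<le> \<bar>z\<bar> \<longleftrightarrow> r\<^sup>2 \<le> z\<^sup>2" for z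
    using abs_le_square_iff[of r z] r by simp
  then have "measure_pmf.prob (pair_pmf R R)
      {(ys, zs). r \<le> \<bar>collision_stat S w ys zs - (real m)\<^sup>2 * (\<Sum>x\<in>S. (f x)\<^sup>2)\<bar>} =
    measure_pmf.prob (pair_pmf R R) {y. r\<^sup>2 \<le> u y}"
    by (intro arg_cong[where f = "measure_pmf.prob (pair_pmf R R)"]) (auto simp: u_def)
  also have "\<dots> \<le> measure_pmf.expectation (pair_pmf R R) u / r\<^sup>2"
    using r by (intro prob_ge_le_expectation R) (auto simp: u_def split: prod.splits)
  also have "\<dots> \<le> ((real m)\<^sup>2 * (\<Sum>x\<in>S. (pmf p x)\<^sup>2)
      + 2 * (real m)^3 * (\<Sum>x\<in>S. (f x)\<^sup>2 * pmf p x)) / r\<^sup>2"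
    unfolding u_def R_def f_def
    by (intro divide_right_mono collision_stat_variance[OF p S]) simp
  finally show ?thesis .
qed

text \<open>Both the mean and the cubic variance term vanish. Chebyshev at distance
  \<open>m^2 * \<tau> / 2\<close> costs a factor 4, and the target 1/6 a factor 6, whence
  24.\<close>

lemma collision_stat_uniform:
  fixes w \<tau> :: real and m :: nat
  assumes p: "finite (set_pmf p)" and S: "finite S" and \<tau>: "0 < \<tau>" and m: "0 < m"
    and unif: "\<And>x. x \<in> S \<Longrightarrow> pmf p x = w"
    and big: "24 * (real (card S) * w\<^sup>2) \<le> (real m * \<tau>)\<^sup>2"
  defines "R \<equiv> replicate_pmf m p"
  shows "5 / 6 \<le> measure_pmf.prob (pair_pmf R R)
      {(ys, zs). collision_stat S w ys zs < (real m)\<^sup>2 * \<tau> / 2}"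
proof -
  let ?A = "{(ys, zs). collision_stat S w ys zs < (real m)\<^sup>2 * \<tau> / 2}"
  let ?r = "(real m)\<^sup>2 * \<tau> / 2"
  have T: "(\<Sum>x\<in>S. (pmf p x - w)\<^sup>2) = 0" "(\<Sum>x\<in>S. (pmf p x - w)\<^sup>2 * pmf p x) = 0"
    "(\<Sum>x\<in>S. (pmf p x)\<^sup>2) = real (card S) * w\<^sup>2"
    using unif by simp_all
  have "measure_pmf.prob (pair_pmf R R) (- ?A)
      \<le> measure_pmf.prob (pair_pmf R R) {(ys, zs). ?r \<le> \<bar>collision_stat S w ys zs\<bar>}"
    by (rule measure_pmf.finite_measure_mono) auto
  also have "\<dots> \<le> ((real m)\<^sup>2 * (real (card S) * w\<^sup>2)) / ?r\<^sup>2"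
    using collision_stat_concentration[OF p S, of ?r m w] \<tau> m by (simp add: T R_def)
  also have "\<dots> \<le> 1 / 6"
    using big \<tau> m by (simp add: field_simps power2_eq_square)
  finally show ?thesis
    using measure_pmf.prob_compl[of ?A "pair_pmf R R"] by (simp add: Compl_eq_Diff_UNIV)
qed

text \<open>The threshold is at most half of the mean \<open>m^2 * T\<close>, so a miss is a
  deviation by at least half the mean. Since \<open>p\<close> differs from \<open>w\<close> by at
  most \<open>sqrt T\<close> on \<open>S\<close>, the relative variance is bounded by four terms
  that decrease in \<open>T\<close>; bounds stated for \<open>\<tau> \<le> T\<close> thus
  suffice.\<close>

lemma collision_stat_far:
  fixes w \<tau> :: real and m :: nat
  assumes p: "finite (set_pmf p)" and S: "finite S" and \<tau>: "0 < \<tau>" and w: "0 \<le> w"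
    and far: "\<tau> \<le> (\<Sum>x\<in>S. (pmf p x - w)\<^sup>2)"
    and big: "192 * (real (card S) * w\<^sup>2) \<le> (real m * \<tau>)\<^sup>2" "192 * w \<le> real m * \<tau>"
      "100 \<le> real m * sqrt \<tau>"
  defines "R \<equiv> replicate_pmf m p"
  shows "measure_pmf.prob (pair_pmf R R)
      {(ys, zs). collision_stat S w ys zs < (real m)\<^sup>2 * \<tau> / 2} \<le> 1 / 6"
proof -
  define f where "f x = pmf p x - w" for x
  define T where "T = (\<Sum>x\<in>S. (f x)\<^sup>2)"
  define s where "s = real (card S)"
  let ?r = "(real m)\<^sup>2 * T / 2"
  have m: "0 < real m" using big(3) by (cases m) auto
  have T: "0 < T" "\<tau> \<le> T" using far \<tau> unfolding T_def f_def by auto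
  have f_le: "\<bar>f x\<bar> \<le> sqrt T" if "x \<in> S" for x
  proof -
    have "(f x)\<^sup>2 \<le> T" unfolding T_def using that S by (intro member_le_sum) auto
    then show ?thesis using real_le_rsqrt by (simp add: real_le_rsqrt)
  qed
  have "(\<Sum>x\<in>S. (pmf p x)\<^sup>2) \<le> (\<Sum>x\<in>S. 2 * (f x)\<^sup>2 + 2 * w\<^sup>2)"
  proof (rule sum_mono)
    fix x
    have "0 \<le> (f x - w)\<^sup>2" by simp
    then show "(pmf p x)\<^sup>2 \<le> 2 * (f x)\<^sup>2 + 2 * w\<^sup>2"
      by (simp add: f_def power2_eq_square algebra_simps)
  qed
  also have "\<dots> = 2 * T + 2 * (s * w\<^sup>2)"
    by (simp add: T_def s_def sum.distrib sum_distrib_left)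
  finally have sq: "(\<Sum>x\<in>S. (pmf p x)\<^sup>2) \<le> 2 * T + 2 * (s * w\<^sup>2)" .
  have "(\<Sum>x\<in>S. (f x)\<^sup>2 * pmf p x) \<le> (\<Sum>x\<in>S. (f x)\<^sup>2 * (w + sqrt T))"
    using f_le by (intro sum_mono mult_left_mono) (force simp: f_def abs_le_iff)+
  also have "\<dots> = T * (w + sqrt T)" by (simp add: T_def sum_distrib_right)
  finally have cube: "(\<Sum>x\<in>S. (f x)\<^sup>2 * pmf p x) \<le> T * (w + sqrt T)" .
  have "measure_pmf.prob (pair_pmf R R) {(ys, zs). collision_stat S w ys zs < (real m)\<^sup>2 * \<tau> / 2}
      \<le> measure_pmf.prob (pair_pmf R R)
          {(ys, zs). ?r \<le> \<bar>collision_stat S w ys zs - (real m)\<^sup>2 * T\<bar>}"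
  proof (rule measure_pmf.finite_measure_mono)
    have "B / 2 \<le> \<bar>z - B\<bar>" if "z < A / 2" "A \<le> B" for z A B :: real
      using that by linarith
    moreover have "(real m)\<^sup>2 * \<tau> \<le> (real m)\<^sup>2 * T" using T by (intro mult_left_mono) auto
    ultimately show "{(ys, zs). collision_stat S w ys zs < (real m)\<^sup>2 * \<tau> / 2} \<subseteq>
        {(ys, zs). ?r \<le> \<bar>collision_stat S w ys zs - (real m)\<^sup>2 * T\<bar>}"
      by blast
  qed simp
  also have "\<dots> \<le> ((real m)\<^sup>2 * (\<Sum>x\<in>S. (pmf p x)\<^sup>2)
      + 2 * (real m)^3 * (\<Sum>x\<in>S. (f x)\<^sup>2 * pmf p x)) / ?r\<^sup>2"
    unfolding R_def f_def T_def
    using T m by (intro collision_stat_concentration[OF p S]) (auto simp: T_def f_def)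
  also have "\<dots> \<le> ((real m)\<^sup>2 * (2 * T + 2 * (s * w\<^sup>2)) + 2 * (real m)^3 * (T * (w + sqrt T))) / ?r\<^sup>2"
    using sq cube by (intro divide_right_mono add_mono mult_left_mono) auto
  also have "\<dots> = 8 / ((real m)\<^sup>2 * T) + 8 * (s * w\<^sup>2) / (real m * T)\<^sup>2 + 8 * w / (real m * T)
      + 8 * (sqrt T / (real m * T))"
    using T m by (simp add: field_simps power2_eq_square power3_eq_cube)
  \<comment> \<open>The constant 192 is 8 * 24; together the four terms amount to about 0.164, just
    below 1/6.\<close>
  also have "\<dots> \<le> 8 / 100\<^sup>2 + 1 / 24 + 1 / 24 + 8 / 100"
  proof (intro add_mono)
    have mT: "real m * \<tau> \<le> real m * T" using T m by simp
    have mrT: "100 \<le> real m * sqrt T"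
      using big(3) T m by (meson mult_left_mono order_less_imp_le order_trans real_sqrt_le_mono)
    then have "100\<^sup>2 \<le> (real m * sqrt T)\<^sup>2" by (intro power_mono) auto
    then have "100\<^sup>2 \<le> (real m)\<^sup>2 * T" using T by (simp add: power_mult_distrib)
    then show "8 / ((real m)\<^sup>2 * T) \<le> 8 / 100\<^sup>2" by (intro divide_left_mono) (auto simp: T m)
    have "(real m * \<tau>)\<^sup>2 \<le> (real m * T)\<^sup>2" using mT \<tau> by (intro power_mono) auto
    then have "192 * (s * w\<^sup>2) \<le> (real m * T)\<^sup>2" using big(1) unfolding s_def by linarith
    then show "8 * (s * w\<^sup>2) / (real m * T)\<^sup>2 \<le> 1 / 24"
      using T m by (simp add: divide_le_eq)
    have "192 * w \<le> real m * T" using big(2) mT by linarith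
    then show "8 * w / (real m * T) \<le> 1 / 24" using T m by (simp add: divide_le_eq)
    have "sqrt T / (real m * T) = 1 / (real m * sqrt T)"
      using T m by (simp add: field_simps)
    also have "\<dots> \<le> 1 / 100" using mrT by (intro divide_left_mono) auto
    finally show "8 * (sqrt T / (real m * T)) \<le> 8 / 100" by simp
  qed
  also have "\<dots> \<le> 1 / 6" by simp
  finally show ?thesis .
qed

section \<open>Isolated points of the random subgraph\<close>

lemma expectation_of_bool:
  "measure_pmf.expectation p (\<lambda>y. of_bool (P y)) = measure_pmf.prob p {y. P y}"
proof -
  have "(\<lambda>y. of_bool (P y)) = indicat_real {y. P y}" by (auto simp: indicator_def)
  then show ?thesis by simp
qed

lemma finite_set_random_subgraph:
  assumes "finite E"
  shows "finite (set_pmf (random_subgraph E \<rho>))"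
  by (rule finite_subset[of _ "Pow E"]) (use assms in \<open>auto simp: random_subgraph_def\<close>)

lemma random_subgraph_subset: "H \<in> set_pmf (random_subgraph E \<rho>) \<Longrightarrow> H \<subseteq> E"
  by (auto simp: random_subgraph_def)

lemma prob_edges_absent:
  assumes E: "finite E" and A: "A \<subseteq> E" and \<rho>: "0 \<le> \<rho>" "\<rho> \<le> 1"
  shows "measure_pmf.prob (random_subgraph E \<rho>) {H. A \<inter> H = {}} = \<rho> ^ card A"
proof -
  let ?B = "\<lambda>e. if e \<in> A then {True} else UNIV"
  have "(\<lambda>del. {e \<in> E. \<not> del e}) -` {H. A \<inter> H = {}} = Pi E ?B"
    using A by (auto simp: Pi_def split: if_splits)
  then have "measure_pmf.prob (random_subgraph E \<rho>) {H. A \<inter> H = {}} =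
      (\<Prod>e\<in>E. measure_pmf.prob (bernoulli_pmf \<rho>) (?B e))"
    by (simp add: random_subgraph_def measure_Pi_pmf_Pi[OF E])
  also have "\<dots> = (\<Prod>e\<in>E. if e \<in> A then \<rho> else 1)"
    using \<rho> by (intro prod.cong) (auto simp: measure_pmf_single)
  also have "\<dots> = \<rho> ^ card A"
    using E A by (simp add: prod.If_cases Int_absorb1)
  finally show ?thesis .
qed

section \<open>Second moments of weights captured by the isolated points\<close>

definition incident :: "nat \<Rightarrow> nat set set" where
  "incident x = {{x - 1, x}, {x, Suc x}}"

lemma isolated_iff:
  "x \<in> isolated n H \<longleftrightarrow> x \<in> {0<..<n - 1} \<and> incident x \<inter> H = {}"
  by (auto simp: isolated_def incident_def)

lemma incident_subset: "x \<in> {0<..<n - 1} \<Longrightarrow> incident x \<subseteq> path_edges n"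
  by (auto simp: incident_def path_edges_def intro: exI[of _ "x - 1"] exI[of _ x])

lemma card_incident: "0 < x \<Longrightarrow> card (incident x) = 2"
  by (auto simp: incident_def doubleton_eq_iff)

lemma card_incident_Un:
  assumes "0 < x" "0 < y" "Suc x < y \<or> Suc y < x"
  shows "card (incident x \<union> incident y) = 4"
proof -
  have "incident x \<inter> incident y = {}"
    using assms by (auto simp: incident_def doubleton_eq_iff)
  then show ?thesis
    using assms by (subst card_Un_disjoint) (auto simp: card_incident, auto simp: incident_def)
qed

text \<open>Placing \<open>E\<close> between the path and the cycle covers both graphs at once: the
  path edges determine the isolation probabilities, and the inclusion in the cycle confines the
  cells.\<close>

locale subgraph_model =
  fixes n :: nat and E :: "nat set set" and \<rho> :: real
  assumes finite_E: "finite E" and path_E: "path_edges n \<subseteq> E"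
    and E_cycle: "E \<subseteq> cycle_edges n" and \<rho>: "0 < \<rho>" "\<rho> \<le> 1"
begin

abbreviation "subgraph \<equiv> random_subgraph E \<rho>"

lemma finite_subgraph: "finite (set_pmf subgraph)"
  by (rule finite_set_random_subgraph[OF finite_E])

lemma prob_isolated:
  assumes "x \<in> {0<..<n - 1}"
  shows "measure_pmf.prob subgraph {H. x \<in> isolated n H} = \<rho>\<^sup>2"
  using prob_edges_absent[OF finite_E, of "incident x" \<rho>] incident_subset[OF assms] path_E \<rho> assms
  by (simp add: isolated_iff card_incident)

text \<open>At distance at least two the four incident edges are distinct, so the events are
  independent; for closer pairs the probability of one event is bound enough.\<close>

lemma prob_isolated_isolated:
  assumes x: "x \<in> {0<..<n - 1}" and y: "y \<in> {0<..<n - 1}"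
  shows "measure_pmf.prob subgraph {H. x \<in> isolated n H \<and> y \<in> isolated n H}
    \<le> \<rho> ^ 4 + \<rho>\<^sup>2 * of_bool (y \<in> {x - 1..Suc x})"
proof (cases "y \<in> {x - 1..Suc x}")
  case True
  have "measure_pmf.prob subgraph {H. x \<in> isolated n H \<and> y \<in> isolated n H}
      \<le> measure_pmf.prob subgraph {H. x \<in> isolated n H}"
    by (rule measure_pmf.finite_measure_mono) auto
  then show ?thesis using prob_isolated[OF x] True \<rho> by (simp add: add_increasing)
next
  case False
  have "{H. x \<in> isolated n H \<and> y \<in> isolated n H} = {H. (incident x \<union> incident y) \<inter> H = {}}"
    using x y by (auto simp: isolated_iff)
  moreover have "incident x \<union> incident y \<subseteq> E"
    using incident_subset[OF x] incident_subset[OF y] path_E by blast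
  moreover have "Suc x < y \<or> Suc y < x" using False by auto
  then have "card (incident x \<union> incident y) = 4" using x y by (intro card_incident_Un) auto
  ultimately show ?thesis
    using prob_edges_absent[OF finite_E, of "incident x \<union> incident y" \<rho>] \<rho> False by simp
qed

lemma sum_isolated:
  "(\<Sum>x\<in>isolated n H. w x) = (\<Sum>x\<in>{0<..<n - 1}. w x * of_bool (x \<in> isolated n H) :: real)"
  by (rule sum.mono_neutral_cong_left) (auto simp: isolated_iff)

lemma expectation_sum_isolated:
  "measure_pmf.expectation subgraph (\<lambda>H. \<Sum>x\<in>isolated n H. w x) =
     \<rho>\<^sup>2 * (\<Sum>x\<in>{0<..<n - 1}. w x)"
proof -
  have "measure_pmf.expectation subgraph (\<lambda>H. \<Sum>x\<in>isolated n H. w x) =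
      (\<Sum>x\<in>{0<..<n - 1}. w x * measure_pmf.prob subgraph {H. x \<in> isolated n H})"
    unfolding sum_isolated
    by (simp add: integrable_measure_pmf_finite[OF finite_subgraph] expectation_of_bool
        del: sum_mult_of_bool_eq)
  then show ?thesis by (simp add: prob_isolated sum_distrib_left mult.commute)
qed

text \<open>Only pairs at distance at most one exceed the product of their probabilities. Each
  \<open>x\<close> has three such partners, itself included, of weight at most \<open>M\<close>
  each.\<close>

lemma expectation_sum_isolated_square:
  assumes w: "\<And>x. 0 \<le> w x" "\<And>x. w x \<le> M"
  shows "measure_pmf.expectation subgraph (\<lambda>H. (\<Sum>x\<in>isolated n H. w x)\<^sup>2)
    \<le> (\<rho>\<^sup>2 * (\<Sum>x\<in>{0<..<n - 1}. w x))\<^sup>2 + 3 * \<rho>\<^sup>2 * M * (\<Sum>x\<in>{0<..<n - 1}. w x)"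
proof -
  let ?I = "{0<..<n - 1}"
  define W where "W = (\<Sum>x\<in>?I. w x)"
  have near: "(\<Sum>y\<in>?I. w y * of_bool (y \<in> {x - 1..Suc x})) \<le> 3 * M" if "x \<in> ?I" for x
  proof -
    have "(\<Sum>y\<in>?I. w y * of_bool (y \<in> {x - 1..Suc x})) = (\<Sum>y\<in>?I \<inter> {x - 1..Suc x}. w y)"
      by (rule sum.mono_neutral_cong_right) auto
    also have "\<dots> \<le> (\<Sum>y\<in>{x - 1..Suc x}. w y)"
      using w by (intro sum_mono2) auto
    also have "\<dots> \<le> (\<Sum>y\<in>{x - 1..Suc x}. M)" using w by (intro sum_mono)
    also have "\<dots> = 3 * M" using that by auto
    finally show ?thesis .
  qed
  have "measure_pmf.expectation subgraph (\<lambda>H. (\<Sum>x\<in>isolated n H. w x)\<^sup>2) =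
      measure_pmf.expectation subgraph (\<lambda>H. \<Sum>x\<in>?I. \<Sum>y\<in>?I.
        w x * w y * of_bool (x \<in> isolated n H \<and> y \<in> isolated n H))"
    unfolding sum_isolated power2_eq_square sum_product by (simp add: of_bool_conj mult_ac)
  also have "\<dots> = (\<Sum>x\<in>?I. \<Sum>y\<in>?I.
      w x * w y * measure_pmf.prob subgraph {H. x \<in> isolated n H \<and> y \<in> isolated n H})"
    by (simp add: integrable_measure_pmf_finite[OF finite_subgraph] expectation_of_bool
        del: of_bool_conj sum_mult_of_bool_eq)
  also have "\<dots> \<le> (\<Sum>x\<in>?I. \<Sum>y\<in>?I. w x * w y * (\<rho> ^ 4 + \<rho>\<^sup>2 * of_bool (y \<in> {x - 1..Suc x})))"
    using w prob_isolated_isolated by (intro sum_mono mult_left_mono mult_nonneg_nonneg) auto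
  also have "\<dots> = \<rho> ^ 4 * (\<Sum>x\<in>?I. \<Sum>y\<in>?I. w x * w y)
      + \<rho>\<^sup>2 * (\<Sum>x\<in>?I. w x * (\<Sum>y\<in>?I. w y * of_bool (y \<in> {x - 1..Suc x})))"
    by (simp add: sum.distrib sum_distrib_left distrib_left mult_ac
        del: atLeastAtMost_iff sum_mult_of_bool_eq)
  also have "\<dots> \<le> \<rho> ^ 4 * (\<Sum>x\<in>?I. \<Sum>y\<in>?I. w x * w y) + \<rho>\<^sup>2 * (\<Sum>x\<in>?I. w x * (3 * M))"
    using w near by (intro add_left_mono mult_left_mono sum_mono) auto
  also have "\<dots> = (\<rho>\<^sup>2 * W)\<^sup>2 + 3 * \<rho>\<^sup>2 * M * W"
    unfolding sum_product[symmetric] sum_distrib_right[symmetric] W_def[symmetric]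
    by (simp add: power2_eq_square power4_eq_xxxx)
  finally show ?thesis unfolding W_def .
qed

text \<open>Chebyshev around the true mean \<open>\<rho>^2 * U\<close>, at half of that mean: the
  variance factor 3 becomes 3 * 4 = 12. The resulting bound decreases in \<open>U\<close>, so
  \<open>V\<close> may replace it.\<close>

lemma prob_sum_isolated_small:
  assumes w: "\<And>x. 0 \<le> w x" "\<And>x. w x \<le> M"
    and W: "0 < V" "V \<le> (\<Sum>x\<in>{0<..<n - 1}. w x)"
  shows "measure_pmf.prob subgraph {H. (\<Sum>x\<in>isolated n H. w x) \<le> \<rho>\<^sup>2 * V / 2}
    \<le> 12 * M / (\<rho>\<^sup>2 * V)"
proof -
  define Z where "Z H = (\<Sum>x\<in>isolated n H. w x)" for H
  define U where "U = (\<Sum>x\<in>{0<..<n - 1}. w x)"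
  have U: "0 < U" "V \<le> U" using W unfolding U_def by auto
  have M: "0 \<le> M" using w order_trans by blast
  have "measure_pmf.prob subgraph {H. Z H \<le> \<rho>\<^sup>2 * V / 2}
      \<le> measure_pmf.prob subgraph {H. (\<rho>\<^sup>2 * U / 2)\<^sup>2 \<le> (Z H - \<rho>\<^sup>2 * U)\<^sup>2}"
  proof (rule measure_pmf.finite_measure_mono)
    show "{H. Z H \<le> \<rho>\<^sup>2 * V / 2} \<subseteq> {H. (\<rho>\<^sup>2 * U / 2)\<^sup>2 \<le> (Z H - \<rho>\<^sup>2 * U)\<^sup>2}"
    proof safe
      fix H assume "Z H \<le> \<rho>\<^sup>2 * V / 2"
      moreover have "\<rho>\<^sup>2 * V \<le> \<rho>\<^sup>2 * U" using U by (intro mult_left_mono) auto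
      ultimately have "\<rho>\<^sup>2 * U / 2 \<le> \<rho>\<^sup>2 * U - Z H" by linarith
      then have "(\<rho>\<^sup>2 * U / 2)\<^sup>2 \<le> (\<rho>\<^sup>2 * U - Z H)\<^sup>2" using U by (intro power_mono) auto
      then show "(\<rho>\<^sup>2 * U / 2)\<^sup>2 \<le> (Z H - \<rho>\<^sup>2 * U)\<^sup>2" by (simp add: power2_commute)
    qed
  qed simp
  also have "\<dots> \<le> measure_pmf.expectation subgraph (\<lambda>H. (Z H - \<rho>\<^sup>2 * U)\<^sup>2) / (\<rho>\<^sup>2 * U / 2)\<^sup>2"
    using U \<rho> by (intro prob_ge_le_expectation finite_subgraph) auto
  also have "\<dots> \<le> (3 * \<rho>\<^sup>2 * M * U) / (\<rho>\<^sup>2 * U / 2)\<^sup>2"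
  proof (rule divide_right_mono)
    show "measure_pmf.expectation subgraph (\<lambda>H. (Z H - \<rho>\<^sup>2 * U)\<^sup>2) \<le> 3 * \<rho>\<^sup>2 * M * U"
      unfolding expectation_square_minus[OF finite_subgraph]
      using expectation_sum_isolated_square[of w M] w expectation_sum_isolated[of w]
      by (simp add: Z_def U_def power2_eq_square mult_ac)
  qed simp
  also have "\<dots> = 12 * M / (\<rho>\<^sup>2 * U)"
    using U \<rho> by (simp add: field_simps power2_eq_square)
  also have "\<dots> \<le> 12 * M / (\<rho>\<^sup>2 * V)"
    using U W(1) \<rho> M by (intro divide_left_mono mult_left_mono mult_pos_pos) auto
  finally show ?thesis unfolding Z_def .
qed

section \<open>Markov bounds for the numbers of isolated points and of deleted path edges\<close>

lemma prob_many_isolated: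
  assumes "0 < n"
  shows "measure_pmf.prob subgraph {H. 20 * (\<rho>\<^sup>2 * real n) \<le> real (card (isolated n H))} \<le> 1 / 20"
proof -
  have "measure_pmf.expectation subgraph (\<lambda>H. real (card (isolated n H))) \<le> \<rho>\<^sup>2 * real n"
    using expectation_sum_isolated[of "\<lambda>_. 1"] by (simp add: mult_left_mono)
  moreover have "measure_pmf.prob subgraph {H. 20 * (\<rho>\<^sup>2 * real n) \<le> real (card (isolated n H))}
      \<le> measure_pmf.expectation subgraph (\<lambda>H. real (card (isolated n H))) / (20 * (\<rho>\<^sup>2 * real n))"
    using assms \<rho> by (intro prob_ge_le_expectation finite_subgraph) auto
  moreover have "\<rho>\<^sup>2 * real n / (20 * (\<rho>\<^sup>2 * real n)) = 1 / 20" using assms \<rho> by simp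
  ultimately show ?thesis
    using assms \<rho> by (smt (verit) divide_right_mono mult_nonneg_nonneg of_nat_0_le_iff zero_le_power2)
qed

text \<open>Neighbours with different labels are separated by a gap, so the size of this set
  controls the query budget.\<close>

definition gaps :: "nat set set \<Rightarrow> nat set" where
  "gaps H = {i \<in> {..<n - 1}. {i, Suc i} \<notin> H}"

lemma prob_many_gaps:
  assumes "0 < n"
  shows "measure_pmf.prob subgraph {H. 20 * (\<rho> * real n) \<le> real (card (gaps H))} \<le> 1 / 20"
proof -
  have card: "real (card (gaps H)) = (\<Sum>i<n - 1. of_bool ({{i, Suc i}} \<inter> H = {}))" for H
    by (auto simp: gaps_def intro!: arg_cong[where f = card])
  have prob: "measure_pmf.prob subgraph {H. {{i, Suc i}} \<inter> H = {}} = \<rho>" if "i < n - 1" for i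
  proof -
    have "{i, Suc i} \<in> path_edges n"
      unfolding path_edges_def using that by (intro CollectI exI[of _ i]) auto
    then have "{{i, Suc i}} \<subseteq> E" using path_E by auto
    then show ?thesis using prob_edges_absent[OF finite_E, of "{{i, Suc i}}" \<rho>] \<rho> by simp
  qed
  have "measure_pmf.expectation subgraph (\<lambda>H. real (card (gaps H))) =
      (\<Sum>i<n - 1. measure_pmf.prob subgraph {H. {{i, Suc i}} \<inter> H = {}})"
    unfolding card
    by (simp add: integrable_measure_pmf_finite[OF finite_subgraph] expectation_of_bool
        del: sum_of_bool_eq)
  also have "\<dots> = real (n - 1) * \<rho>" using prob by simp
  also have "\<dots> \<le> \<rho> * real n" using \<rho> by (simp add: mult.commute mult_left_mono)
  finally have "measure_pmf.expectation subgraph (\<lambda>H. real (card (gaps H))) \<le> \<rho> * real n" .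
  moreover have "measure_pmf.prob subgraph {H. 20 * (\<rho> * real n) \<le> real (card (gaps H))}
      \<le> measure_pmf.expectation subgraph (\<lambda>H. real (card (gaps H))) / (20 * (\<rho> * real n))"
    using assms \<rho> by (intro prob_ge_le_expectation finite_subgraph) auto
  moreover have "\<rho> * real n / (20 * (\<rho> * real n)) = 1 / 20" using assms \<rho> by simp
  ultimately show ?thesis
    using assms \<rho> by (smt (verit) divide_right_mono mult_nonneg_nonneg of_nat_0_le_iff zero_le_power2)
qed

end

section \<open>The tester\<close>

text \<open>The parameter \<open>\<tau>\<close> stands for the squared L2 distance guaranteed on the
  isolated points when \<open>\<mu>\<close> is far; the threshold lies halfway between the mean 0 of
  the uniform case and \<open>m^2 * \<tau>\<close>.\<close>

definition tester :: "nat \<Rightarrow> nat \<Rightarrow> nat \<Rightarrow> nat \<Rightarrow> real \<Rightarrow> algorithm" where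
  "tester n d fuel m \<tau> = learn n d fuel (\<lambda>g. draw m (\<lambda>ys. draw m (\<lambda>zs.
     Decide (collision_stat (singletons n g) (1 / real n) ys zs < (real m)\<^sup>2 * \<tau> / 2))))"

lemma uses_at_most_tester:
  "2 \<le> n \<Longrightarrow> uses_at_most n (m + (m + 0)) (Suc (Suc (Suc fuel))) (tester n d fuel m \<tau>)"
  unfolding tester_def
  by (intro uses_at_most_learn uses_at_most_draw uses_at_most.Decide)

lemma singletons_cong: "(\<And>x. x < n \<Longrightarrow> c x = c' x) \<Longrightarrow> singletons n c = singletons n c'"
  by (auto simp: singletons_def)

lemma run_tester:
  fixes c :: "nat \<Rightarrow> nat" and \<mu> :: "nat pmf" and m :: nat
  assumes "3 \<le> n" "n \<le> 2 ^ d" "no_return c 0 (n div 2)" "no_return c (n div 2) (n - 1)"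
    and "d * jumps c 0 (n - 1) \<le> fuel"
  defines "R \<equiv> replicate_pmf m (map_pmf c \<mu>)"
  shows "run \<mu> c (tester n d fuel m \<tau>) =
    map_pmf (\<lambda>(ys, zs). collision_stat (singletons n c) (1 / real n) ys zs < (real m)\<^sup>2 * \<tau> / 2)
      (pair_pmf R R)"
proof -
  have "singletons n (\<lambda>x. if x < n then c x else 0) = singletons n c"
    by (rule singletons_cong) simp
  then show ?thesis
    unfolding tester_def run_learn[OF assms(1-5)]
    by (simp add: run_draw R_def pair_pmf_def map_bind_pmf bind_assoc_pmf bind_return_pmf
        map_pmf_def[symmetric] pmf.map_comp o_def)
qed

lemma pmf_label_isolated:
  assumes c: "c \<in> set_pmf (random_labelling n H)" and H: "H \<subseteq> cycle_edges n"
    and x: "x \<in> isolated n H" and \<mu>: "set_pmf \<mu> \<subseteq> {..<n}"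
  shows "pmf (map_pmf c \<mu>) x = pmf \<mu> x"
proof -
  have "pmf (map_pmf c \<mu>) x = measure_pmf.prob \<mu> (c -` {x})" by (simp add: pmf_map)
  also have "\<dots> = measure_pmf.prob \<mu> {x}"
    by (rule measure_pmf.finite_measure_eq_AE)
      (use isolated_label[OF c H x] \<mu> in \<open>auto simp: AE_measure_pmf_iff\<close>)
  finally show ?thesis by (simp add: measure_pmf_single)
qed

section \<open>Correctness\<close>

lemma pmf_uniform: "x < n \<Longrightarrow> pmf (pmf_of_set {..<n}) x = 1 / real n"
  by (subst pmf_of_set) (auto simp: lessThan_empty_iff)

context subgraph_model
begin

text \<open>The first bound limits the query cost, the second the noise of the statistic and the
  loss in Cauchy-Schwarz. The isolated points in the two halves supply the deleted edge that
  \<open>no_return\<close> requires outside the opposite half.\<close>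

definition good :: "nat set set \<Rightarrow> bool" where
  "good H \<longleftrightarrow> real (card (gaps H)) < 20 * (\<rho> * real n)
     \<and> real (card (isolated n H)) < 20 * (\<rho>\<^sup>2 * real n)
     \<and> (\<exists>x\<in>isolated n H. x \<le> n div 2) \<and> (\<exists>x\<in>isolated n H. n div 2 \<le> x)"

text \<open>The capture bound with the indicator of \<open>A\<close> as weight, \<open>M = 1\<close>
  and \<open>V = n / 4\<close>.\<close>

lemma prob_no_isolated:
  assumes n: "10 ^ 4 \<le> \<rho>\<^sup>2 * real n" and A: "real n / 4 \<le> real (card ({0<..<n - 1} \<inter> A))"
  shows "measure_pmf.prob subgraph {H. isolated n H \<inter> A = {}} \<le> 48 / 10 ^ 4"
proof -
  have n0: "0 < real n" using n by (cases n) auto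
  have "measure_pmf.prob subgraph {H. isolated n H \<inter> A = {}} \<le>
      measure_pmf.prob subgraph {H. (\<Sum>x\<in>isolated n H. of_bool (x \<in> A)) \<le> \<rho>\<^sup>2 * (real n / 4) / 2}"
    using n by (intro measure_pmf.finite_measure_mono) (auto intro!: mult_nonneg_nonneg)
  also have "\<dots> \<le> 12 * 1 / (\<rho>\<^sup>2 * (real n / 4))"
    using A n0 by (intro prob_sum_isolated_small) (auto simp: Int_def)
  also have "\<dots> = 48 / (\<rho>\<^sup>2 * real n)" by simp
  also have "\<dots> \<le> 48 / 10 ^ 4" using n by (intro divide_left_mono) auto
  finally show ?thesis .
qed

lemma prob_not_good:
  assumes n: "10 ^ 4 \<le> \<rho>\<^sup>2 * real n"
  shows "measure_pmf.prob subgraph {H. \<not> good H} \<le> 11 / 100"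
proof -
  have "\<rho>\<^sup>2 \<le> 1" using \<rho> by (simp add: power_le_one)
  then have "\<rho>\<^sup>2 * real n \<le> 1 * real n" by (intro mult_right_mono) auto
  with n have "10 ^ 4 \<le> real n" by linarith
  then have n4: "10 ^ 4 \<le> n" by simp
  let ?P = "measure_pmf.prob subgraph"
  let ?A = "{H. 20 * (\<rho> * real n) \<le> real (card (gaps H))}"
  let ?B = "{H. 20 * (\<rho>\<^sup>2 * real n) \<le> real (card (isolated n H))}"
  let ?C = "{H. isolated n H \<inter> {..n div 2} = {}}"
  let ?D = "{H. isolated n H \<inter> {n div 2..} = {}}"
  have "?P {H. \<not> good H} \<le> ?P ((?A \<union> ?B) \<union> (?C \<union> ?D))"
    by (rule measure_pmf.finite_measure_mono) (auto simp: good_def not_less not_le)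
  also have "\<dots> \<le> (?P ?A + ?P ?B) + (?P ?C + ?P ?D)"
    by (intro order_trans[OF measure_Un_le] add_mono
        measure_Un_le) auto
  also have "\<dots> \<le> (1 / 20 + 1 / 20) + (48 / 10 ^ 4 + 48 / 10 ^ 4)"
  proof (intro add_mono prob_many_gaps prob_many_isolated prob_no_isolated n)
    have "{0<..<n - 1} \<inter> {..n div 2} = {0<..n div 2}" using n4 by auto
    then show "real n / 4 \<le> real (card ({0<..<n - 1} \<inter> {..n div 2}))" using n4 by simp
    have "{0<..<n - 1} \<inter> {n div 2..} = {n div 2..<n - 1}" using n4 by auto
    then show "real n / 4 \<le> real (card ({0<..<n - 1} \<inter> {n div 2..}))" using n4 by simp
  qed (use n4 in auto)
  also have "\<dots> \<le> 11 / 100" by simp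
  finally show ?thesis .
qed

lemma good_learnable:
  assumes H: "H \<subseteq> E" "good H" and c: "c \<in> set_pmf (random_labelling n H)"
  shows "no_return c 0 (n div 2)" "no_return c (n div 2) (n - 1)"
    and "real (jumps c 0 (n - 1)) \<le> 20 * (\<rho> * real n)"
proof -
  have H': "H \<subseteq> cycle_edges n" using H(1) E_cycle by blast
  from H(2) obtain x y where x: "x \<in> isolated n H" "x \<le> n div 2"
    and y: "y \<in> isolated n H" "n div 2 \<le> y" unfolding good_def by blast
  show "no_return c 0 (n div 2)"
    by (rule no_return_if_outside_deleted[OF c H', where j = y])
      (use y in \<open>auto simp: isolated_def\<close>)
  show "no_return c (n div 2) (n - 1)"
    by (rule no_return_if_outside_deleted[OF c H', where j = "x - 1"])
      (use x in \<open>auto simp: isolated_def\<close>)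
  have "jumps c 0 (n - 1) \<le> card (gaps H)"
    unfolding jumps_def gaps_def by (intro card_mono) (auto dest: jump_edge[OF c])
  then show "real (jumps c 0 (n - 1)) \<le> 20 * (\<rho> * real n)"
    using H(2) unfolding good_def by linarith
qed

text \<open>The error budget: 4/5 for the subgraph times 5/6 for the samples is exactly 2/3.\<close>

lemma verdict_ge:
  assumes G: "measure_pmf.prob subgraph {H. \<not> G H} \<le> 1 / 5"
    and run: "\<And>H c. H \<subseteq> E \<Longrightarrow> G H \<Longrightarrow> c \<in> set_pmf (random_labelling n H) \<Longrightarrow>
      5 / 6 \<le> pmf (run \<mu> c a) b"
  shows "1 - 1 / 3 \<le> pmf (verdict n E \<rho> \<mu> a) b"
proof -
  have "4 / 5 \<le> measure_pmf.prob subgraph {H. G H}"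
    using G measure_pmf.prob_compl[of "{H. G H}" subgraph]
    by (simp add: Compl_eq_Diff_UNIV[symmetric] Collect_neg_eq)
  moreover have "1 * (5 / 6) \<le> pmf (bind_pmf (random_labelling n H) (\<lambda>c. run \<mu> c a)) b"
    if "H \<in> set_pmf subgraph" "G H" for H
    using run[OF random_subgraph_subset[OF that(1)] that(2)]
    by (intro pmf_bind_ge[where G = UNIV]) auto
  ultimately have "4 / 5 * (1 * (5 / 6)) \<le>
      pmf (bind_pmf subgraph (\<lambda>H. bind_pmf (random_labelling n H) (\<lambda>c. run \<mu> c a))) b"
    by (intro pmf_bind_ge[where G = "{H. G H}"]) auto
  then show ?thesis by (simp add: verdict_def random_clustering_def bind_assoc_pmf)
qed

text \<open>Excess and deficit balance because both masses are 1, so half of the L1 distance is the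
  total deficit.\<close>

lemma tv_dist_uniform:
  assumes n: "0 < n" and \<mu>: "set_pmf \<mu> \<subseteq> {..<n}"
  shows "tv_dist n \<mu> (pmf_of_set {..<n}) = (\<Sum>x<n. max 0 (1 / real n - pmf \<mu> x))"
proof -
  have "(\<Sum>x<n. \<bar>pmf \<mu> x - pmf (pmf_of_set {..<n}) x\<bar>) =
      (\<Sum>x<n. 2 * max 0 (1 / real n - pmf \<mu> x) + (pmf \<mu> x - 1 / real n))"
    by (intro sum.cong) (auto simp: max_def pmf_uniform)
  moreover have "(\<Sum>x<n. pmf \<mu> x) = 1" using sum_pmf_eq_1[OF _ \<mu>] by simp
  ultimately show ?thesis
    unfolding tv_dist_def using n by (simp add: sum.distrib sum_subtractf sum_distrib_left[symmetric])
qed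

text \<open>The deficit of a far \<open>\<mu>\<close> below the uniform distribution is at most \<open>1 / n\<close> at every point,
  hence so spread out that the isolated points capture their expected share of it.\<close>

lemma prob_small_discrepancy:
  assumes \<mu>: "set_pmf \<mu> \<subseteq> {..<n}" and \<epsilon>: "0 < \<epsilon>" and big: "10 ^ 4 \<le> \<rho>\<^sup>2 * real n * \<epsilon>"
    and far: "tv_dist n \<mu> (pmf_of_set {..<n}) > \<epsilon>"
  shows "measure_pmf.prob subgraph {H. \<not> (good H \<longrightarrow>
    \<rho>\<^sup>2 * \<epsilon>\<^sup>2 / (320 * real n) \<le> (\<Sum>x\<in>isolated n H. (pmf \<mu> x - 1 / real n)\<^sup>2))} \<le> 24 / 10 ^ 4"
proof -
  define w where "w x = max 0 (1 / real n - pmf \<mu> x)" for x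
  have n0: "0 < real n" using big by (cases n) auto
  have "\<rho>\<^sup>2 \<le> 1" using \<rho> by (simp add: power_le_one)
  then have "\<rho>\<^sup>2 * (real n * \<epsilon>) \<le> 1 * (real n * \<epsilon>)" using \<epsilon> by (intro mult_right_mono) auto
  with big have n\<epsilon>: "10 ^ 4 \<le> real n * \<epsilon>" by (simp add: mult.assoc)
  have w: "0 \<le> w x" "w x \<le> 1 / real n" for x unfolding w_def by auto
  have "\<epsilon> < (\<Sum>x<n. w x)" using far tv_dist_uniform[OF _ \<mu>] n0 unfolding w_def by simp
  \<comment> \<open>The end points are never in \<open>isolated\<close>; together they carry a
    deficit of at most \<open>2 / n \<le> \<epsilon> / 2\<close>.\<close>
  also have "\<dots> \<le> (\<Sum>x\<in>{0<..<n - 1} \<union> {0, n - 1}. w x)"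
    using w by (intro sum_mono2) auto
  also have "\<dots> \<le> (\<Sum>x\<in>{0<..<n - 1}. w x) + (\<Sum>x\<in>{0, n - 1}. w x)"
    using w by (subst sum_Un) (auto intro: sum_nonneg)
  also have "(\<Sum>x\<in>{0, n - 1}. w x) \<le> w 0 + w (n - 1)"
    using w by (cases "n - 1 = 0") auto
  also have "\<dots> \<le> 2 / real n" using w[of 0] w[of "n - 1"] by (simp add: field_simps)
  also have "\<dots> \<le> \<epsilon> / 2" using n\<epsilon> n0 by (simp add: field_simps)
  finally have V: "\<epsilon> / 2 \<le> (\<Sum>x\<in>{0<..<n - 1}. w x)" by linarith
  have "\<rho>\<^sup>2 * \<epsilon>\<^sup>2 / (320 * real n) \<le> (\<Sum>x\<in>isolated n H. (pmf \<mu> x - 1 / real n)\<^sup>2)"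
    if g: "good H" and large: "\<rho>\<^sup>2 * (\<epsilon> / 2) / 2 < (\<Sum>x\<in>isolated n H. w x)" for H
  proof -
    let ?T = "\<Sum>x\<in>isolated n H. (pmf \<mu> x - 1 / real n)\<^sup>2"
    \<comment> \<open>Cauchy-Schwarz over at most \<open>20 * \<rho>^2 * n\<close> points; the left
      side is \<open>\<rho>^4 * \<epsilon>^2 / 16\<close>, which explains 320 = 16 * 20.\<close>
    have "(\<rho>\<^sup>2 * (\<epsilon> / 2) / 2)\<^sup>2 \<le> (\<Sum>x\<in>isolated n H. w x)\<^sup>2"
      using large \<epsilon> by (intro power_mono) auto
    also have "\<dots> \<le> (\<Sum>x\<in>isolated n H. (w x)\<^sup>2) * real (card (isolated n H))"
      by (rule sum_squared_le_sum_of_squares)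
    also have "\<dots> \<le> ?T * (20 * (\<rho>\<^sup>2 * real n))"
    proof (intro mult_mono sum_mono)
      show "(w x)\<^sup>2 \<le> (pmf \<mu> x - 1 / real n)\<^sup>2" for x
        unfolding w_def by (auto simp: max_def power2_commute)
    qed (use g in \<open>auto simp: good_def intro: sum_nonneg\<close>)
    finally show ?thesis using \<rho> n0 by (simp add: field_simps power2_eq_square)
  qed
  then have "measure_pmf.prob subgraph {H. \<not> (good H \<longrightarrow>
      \<rho>\<^sup>2 * \<epsilon>\<^sup>2 / (320 * real n) \<le> (\<Sum>x\<in>isolated n H. (pmf \<mu> x - 1 / real n)\<^sup>2))} \<le>
    measure_pmf.prob subgraph {H. (\<Sum>x\<in>isolated n H. w x) \<le> \<rho>\<^sup>2 * (\<epsilon> / 2) / 2}"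
    by (intro measure_pmf.finite_measure_mono) (auto simp: not_le[symmetric])
  also have "\<dots> \<le> 12 * (1 / real n) / (\<rho>\<^sup>2 * (\<epsilon> / 2))"
    using w V \<epsilon> by (intro prob_sum_isolated_small) auto
  also have "\<dots> = 24 / (\<rho>\<^sup>2 * real n * \<epsilon>)" by (simp add: field_simps)
  also have "\<dots> \<le> 24 / 10 ^ 4" using big by (intro divide_left_mono) auto
  finally show ?thesis .
qed

text \<open>The size conditions of the collision lemmas reduce to the bound on \<open>m\<close>, its
  consequence \<open>m * \<tau> \<ge> 300 * \<rho> / sqrt n\<close>, and
  \<open>\<rho> * sqrt n \<ge> 100\<close>. On good subgraphs the noise \<open>card * w^2\<close> is
  of order \<open>\<rho>^2 / n\<close>, the order of the square of that lower bound.\<close>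

lemma tester_correct:
  assumes \<epsilon>: "0 < \<epsilon>" "\<epsilon> < 1" and big: "10 ^ 4 \<le> \<rho>\<^sup>2 * real n * \<epsilon>"
    and d: "n \<le> 2 ^ d" and fuel: "real d * (20 * (\<rho> * real n)) \<le> real fuel"
    and m: "10 ^ 5 * (sqrt (real n) / (\<rho> * \<epsilon>\<^sup>2)) \<le> real m"
  shows "uniformity_tester n E \<epsilon> \<rho> (1 / 3) (tester n d fuel m (\<rho>\<^sup>2 * \<epsilon>\<^sup>2 / (320 * real n)))"
proof -
  define \<tau> where "\<tau> = \<rho>\<^sup>2 * \<epsilon>\<^sup>2 / (320 * real n)"
  have n0: "0 < real n" using big by (cases n) auto
  have \<tau>: "0 < \<tau>" unfolding \<tau>_def using \<rho> \<epsilon> n0 by simp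
  have "\<rho>\<^sup>2 * real n * \<epsilon> \<le> \<rho>\<^sup>2 * real n * 1" using \<epsilon> by (intro mult_left_mono) auto
  with big have \<rho>n: "10 ^ 4 \<le> \<rho>\<^sup>2 * real n" by simp
  have "\<rho>\<^sup>2 \<le> 1" using \<rho> by (simp add: power_le_one)
  then have "\<rho>\<^sup>2 * real n \<le> 1 * real n" by (intro mult_right_mono) auto
  with \<rho>n have "10 ^ 4 \<le> real n" by linarith
  then have n3: "3 \<le> n" by simp
  have \<rho>sqrt: "100 \<le> \<rho> * sqrt (real n)"
    by (rule power2_le_imp_le) (use \<rho>n \<rho> in \<open>auto simp: power_mult_distrib\<close>)
  \<comment> \<open>Here 625/2 is \<open>10 ^ 5 / 320\<close>; it is rounded down to 300
    below.\<close>
  have "10 ^ 5 * (sqrt (real n) / (\<rho> * \<epsilon>\<^sup>2)) * \<tau> = 625 / 2 * (\<rho> * (sqrt (real n) / real n))"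
    unfolding \<tau>_def using \<rho> \<epsilon> n0 by (simp add: field_simps power2_eq_square)
  also have "\<dots> = 625 / 2 * (\<rho> / sqrt (real n))"
    using n0 by (simp add: real_div_sqrt field_simps)
  finally have "625 / 2 * (\<rho> / sqrt (real n)) \<le> real m * \<tau>"
    using mult_right_mono[OF m, of \<tau>] \<tau> by linarith
  moreover have "0 \<le> \<rho> / sqrt (real n)" using \<rho> by simp
  ultimately have m\<tau>: "300 * (\<rho> / sqrt (real n)) \<le> real m * \<tau>" by linarith
  have "(300 * (\<rho> / sqrt (real n)))\<^sup>2 \<le> (real m * \<tau>)\<^sup>2"
    using m\<tau> \<rho> n0 by (intro power_mono) auto
  then have m\<tau>2: "90000 * (\<rho>\<^sup>2 / real n) \<le> (real m * \<tau>)\<^sup>2"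
    using n0 by (simp add: power_mult_distrib power_divide)
  \<comment> \<open>Multiplying the lower bounds for \<open>m\<close> and \<open>m * \<tau>\<close>
    cancels \<open>\<rho>\<close> and \<open>n\<close>, and leaves a constant over
    \<open>\<epsilon>^2\<close>.\<close>
  have "(3 * 10 ^ 7 :: real) \<le> 3 * 10 ^ 7 / \<epsilon>\<^sup>2"
    using \<epsilon> by (simp add: le_divide_eq power_le_one)
  also have "\<dots> = 10 ^ 5 * (sqrt (real n) / (\<rho> * \<epsilon>\<^sup>2)) * (300 * (\<rho> / sqrt (real n)))"
    using \<rho> \<epsilon> n0 by (simp add: field_simps)
  also have "\<dots> \<le> real m * (real m * \<tau>)"
    using \<rho> by (intro mult_mono[OF m m\<tau>]) auto
  also have "\<dots> = (real m * sqrt \<tau>)\<^sup>2"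
    using \<tau> by (simp add: power_mult_distrib power2_eq_square)
  finally have "100\<^sup>2 \<le> (real m * sqrt \<tau>)\<^sup>2" by simp
  then have m\<tau>3: "100 \<le> real m * sqrt \<tau>"
    by (rule power2_le_imp_le) (use \<tau> in simp)
  have "192 * (1 / real n) \<le> 300 * (\<rho> * sqrt (real n)) / real n"
    using \<rho>sqrt n0 by (simp add: divide_right_mono)
  also have "\<dots> = 300 * (\<rho> / sqrt (real n))"
    using n0 by (simp add: field_simps)
  finally have m\<tau>4: "192 * (1 / real n) \<le> real m * \<tau>" using m\<tau> by linarith
  have m0: "0 < m" using m\<tau>3 by (cases m) auto
  have sw: "192 * (real (card (isolated n H)) * (1 / real n)\<^sup>2) \<le> (real m * \<tau>)\<^sup>2" if "good H" for H
  proof -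
    have "real (card (isolated n H)) * (1 / real n)\<^sup>2 \<le> 20 * (\<rho>\<^sup>2 * real n) * (1 / real n)\<^sup>2"
      using that unfolding good_def by (intro mult_right_mono) auto
    also have "\<dots> = 20 * (\<rho>\<^sup>2 / real n)" using n0 by (simp add: power2_eq_square)
    also have "192 * \<dots> \<le> 90000 * (\<rho>\<^sup>2 / real n)" by (simp add: divide_right_mono)
    finally show ?thesis using m\<tau>2 by linarith
  qed
  have run: "run \<mu> c (tester n d fuel m \<tau>) = map_pmf
      (\<lambda>(ys, zs). collision_stat (isolated n H) (1 / real n) ys zs < (real m)\<^sup>2 * \<tau> / 2)
      (pair_pmf (replicate_pmf m (map_pmf c \<mu>)) (replicate_pmf m (map_pmf c \<mu>)))"
    if H: "H \<subseteq> E" "good H" "c \<in> set_pmf (random_labelling n H)" for \<mu> H c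
  proof -
    have "real d * real (jumps c 0 (n - 1)) \<le> real d * (20 * (\<rho> * real n))"
      using good_learnable(3)[OF H] by (intro mult_left_mono) auto
    then have "real (d * jumps c 0 (n - 1)) \<le> real fuel" using fuel by simp
    then have "d * jumps c 0 (n - 1) \<le> fuel" by linarith
    moreover have "singletons n c = isolated n H"
      by (rule singletons_eq_isolated[OF H(3)]) (use H(1) E_cycle in blast)
    ultimately show ?thesis using run_tester[OF n3 d good_learnable(1,2)[OF H]] by simp
  qed
  show ?thesis
    unfolding uniformity_tester_def \<tau>_def[symmetric]
  proof (intro allI impI conjI)
    fix \<mu> :: "nat pmf" assume \<mu>: "set_pmf \<mu> \<subseteq> {..<n}"
    have fin: "finite (set_pmf (map_pmf c \<mu>))" for c
      using finite_subset[OF \<mu>] by simp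
    {
      assume unif: "\<mu> = pmf_of_set {..<n}"
      have "5 / 6 \<le> pmf (run \<mu> c (tester n d fuel m \<tau>)) True"
        if H: "H \<subseteq> E" "good H" "c \<in> set_pmf (random_labelling n H)" for H c
      proof -
        have "pmf (map_pmf c \<mu>) x = 1 / real n" if x: "x \<in> isolated n H" for x
        proof -
          have "x < n" using x by (auto simp: isolated_def)
          then show ?thesis
            using pmf_label_isolated[OF H(3) _ x \<mu>] H(1) E_cycle by (auto simp: unif pmf_uniform)
        qed
        moreover have "0 \<le> real (card (isolated n H)) * (1 / real n)\<^sup>2" by simp
        then have "24 * (real (card (isolated n H)) * (1 / real n)\<^sup>2) \<le> (real m * \<tau>)\<^sup>2"
          using sw[OF H(2)] by linarith
        ultimately show ?thesis
          unfolding run[OF H]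
          using collision_stat_uniform[OF fin[of c] finite_isolated \<tau> m0, of n H "1 / real n"]
          by (simp add: pmf_map vimage_def case_prod_unfold)
      qed
      then show "1 - 1 / 3 \<le> pmf (verdict n E \<rho> \<mu> (tester n d fuel m \<tau>)) True"
        using prob_not_good[OF \<rho>n] by (intro verdict_ge[where G = good]) auto
    }
    {
      assume far: "tv_dist n \<mu> (pmf_of_set {..<n}) > \<epsilon>"
      define G where "G H \<longleftrightarrow> good H \<and> \<tau> \<le> (\<Sum>x\<in>isolated n H. (pmf \<mu> x - 1 / real n)\<^sup>2)" for H
      have "measure_pmf.prob subgraph {H. \<not> G H} \<le>
          measure_pmf.prob subgraph ({H. \<not> good H} \<union>
            {H. \<not> (good H \<longrightarrow> \<tau> \<le> (\<Sum>x\<in>isolated n H. (pmf \<mu> x - 1 / real n)\<^sup>2))})"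
        by (rule measure_pmf.finite_measure_mono) (auto simp: G_def)
      also have "\<dots> \<le> 11 / 100 + 24 / 10 ^ 4"
        using prob_small_discrepancy[OF \<mu> \<epsilon>(1) big far] prob_not_good[OF \<rho>n]
        unfolding \<tau>_def
        by (intro order_trans[OF measure_Un_le] add_mono) auto
      also have "\<dots> \<le> 1 / 5" by simp
      finally have prob: "measure_pmf.prob subgraph {H. \<not> G H} \<le> 1 / 5" .
      have "5 / 6 \<le> pmf (run \<mu> c (tester n d fuel m \<tau>)) False"
        if H: "H \<subseteq> E" "G H" "c \<in> set_pmf (random_labelling n H)" for H c
      proof -
        have g: "good H" using H(2) by (simp add: G_def)
        have "pmf (map_pmf c \<mu>) x = pmf \<mu> x" if x: "x \<in> isolated n H" for x
          using pmf_label_isolated[OF H(3) _ x \<mu>] H(1) E_cycle by blast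
        then have "\<tau> \<le> (\<Sum>x\<in>isolated n H. (pmf (map_pmf c \<mu>) x - 1 / real n)\<^sup>2)"
          using H(2) by (simp add: G_def)
        from collision_stat_far[OF fin finite_isolated \<tau> _ this sw[OF g] m\<tau>4 m\<tau>3]
        have "pmf (run \<mu> c (tester n d fuel m \<tau>)) True \<le> 1 / 6"
          unfolding run[OF H(1) g H(3)] by (simp add: pmf_map vimage_def case_prod_unfold)
        then show ?thesis by (simp add: pmf_False_conv_True)
      qed
      then show "1 - 1 / 3 \<le> pmf (verdict n E \<rho> \<mu> (tester n d fuel m \<tau>)) False"
        using prob by (intro verdict_ge[where G = G]) auto
    }
  qed
qed

end

section \<open>Explicit constants and the resolution bound\<close>

theorem theorem4p38:
  "\<exists>L>0::real. \<exists>C>0::real. \<exists>C'>0::real. \<forall>\<^sub>F n in sequentially.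
     \<forall>E \<in> {path_edges n, cycle_edges n}. \<forall>\<epsilon> \<rho> :: real.
       0 < \<epsilon> \<and> \<epsilon> < 1 \<and> L * (real n * \<epsilon>) powr (- 1 / 4) \<le> \<rho> \<and> \<rho> \<le> 1 \<longrightarrow>
       (\<exists>a s q. uniformity_tester n E \<epsilon> \<rho> (1 / 3) a \<and> uses_at_most n s q a \<and>
          real s \<le> C * (sqrt (real n) / (\<rho> * \<epsilon>\<^sup>2)) \<and>
          real q \<le> C' * (\<rho> * real n * ln (real n)))"
proof (intro exI conjI)
  show "\<forall>\<^sub>F n in sequentially.
     \<forall>E \<in> {path_edges n, cycle_edges n}. \<forall>\<epsilon> \<rho> :: real.
       0 < \<epsilon> \<and> \<epsilon> < 1 \<and> 10 * (real n * \<epsilon>) powr (- 1 / 4) \<le> \<rho> \<and> \<rho> \<le> 1 \<longrightarrow>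
       (\<exists>a s q. uniformity_tester n E \<epsilon> \<rho> (1 / 3) a \<and> uses_at_most n s q a \<and>
          real s \<le> 200002 * (sqrt (real n) / (\<rho> * \<epsilon>\<^sup>2)) \<and>
          real q \<le> 64 * (\<rho> * real n * ln (real n)))"
    using eventually_ge_at_top[of "2::nat"]
  proof eventually_elim
    case (elim n)
    show ?case
    proof (intro ballI allI impI)
      fix E and \<epsilon> \<rho> :: real
      assume E: "E \<in> {path_edges n, cycle_edges n}"
        and *: "0 < \<epsilon> \<and> \<epsilon> < 1 \<and> 10 * (real n * \<epsilon>) powr (- 1 / 4) \<le> \<rho> \<and> \<rho> \<le> 1"
      define z where "z = (real n * \<epsilon>) powr (- 1 / 4)"
      have n\<epsilon>: "0 < real n * \<epsilon>" using elim * by simp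
      have "0 < z" unfolding z_def using elim * by simp
      then have \<rho>: "0 < \<rho>" "\<rho> \<le> 1" using * unfolding z_def by linarith+
      have "z ^ 4 = (real n * \<epsilon>) powr (- 1)"
        unfolding z_def using elim * by (subst powr_power) auto
      then have z4: "z ^ 4 * (real n * \<epsilon>) = 1" using elim * by (simp add: powr_minus field_simps)
      \<comment> \<open>With \<open>L = 10\<close> the resolution bound reads
        \<open>\<rho>^4 * n * \<epsilon> \<ge> 10^4\<close>, and \<open>\<rho> \<le> 1\<close> turns
        this into the form required by \<open>tester_correct\<close>.\<close>
      have "(10 * z) ^ 4 \<le> \<rho> ^ 4" using * \<open>0 < z\<close> unfolding z_def by (intro power_mono) auto
      also have "\<dots> \<le> \<rho>\<^sup>2" using \<rho> by (intro power_decreasing) auto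
      finally have "(10 * z) ^ 4 * (real n * \<epsilon>) \<le> \<rho>\<^sup>2 * (real n * \<epsilon>)"
        using n\<epsilon> by (intro mult_right_mono) auto
      then have big: "10 ^ 4 \<le> \<rho>\<^sup>2 * real n * \<epsilon>"
        using z4 by (simp add: power_mult_distrib mult.assoc)
      have fin: "finite (path_edges n)"
        by (rule finite_subset[of _ "Pow {..<n}"]) (auto simp: path_edges_def)
      interpret subgraph_model n E \<rho>
        using E fin \<rho> by unfold_locales (auto simp: cycle_edges_def)
      have "\<rho>\<^sup>2 * real n * \<epsilon> \<le> \<rho> * real n * 1"
        using \<rho> * by (intro mult_mono) (auto simp: power2_eq_square mult_left_le)
      with big have \<rho>n: "10 ^ 4 \<le> \<rho> * real n" by simp
      have "ln (real 2) \<le> ln (real n)" using elim by (subst ln_le_cancel_iff) auto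
      then have ln: "2 / 3 \<le> ln (real n)" using ln2_ge_two_thirds by simp
      define X where "X = sqrt (real n) / (\<rho> * \<epsilon>\<^sup>2)"
      define Y where "Y = \<rho> * real n * ln (real n)"
      define m where "m = nat \<lceil>10 ^ 5 * X\<rceil>"
      define d where "d = nat \<lceil>log 2 (real n)\<rceil>"
      define fuel where "fuel = nat \<lceil>60 * Y\<rceil>"
      have "\<rho> * \<epsilon>\<^sup>2 \<le> 1" using \<rho> * by (intro mult_le_one) (auto simp: power_le_one)
      moreover have "1 \<le> sqrt (real n)" using elim by simp
      ultimately have "\<rho> * \<epsilon>\<^sup>2 \<le> sqrt (real n)" by linarith
      then have X: "1 \<le> X" unfolding X_def using \<rho> * by (simp add: le_divide_eq)
      have "1 \<le> 10 ^ 4 * (2 / 3 :: real)" by simp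
      also have "\<dots> \<le> Y" unfolding Y_def using \<rho>n ln by (intro mult_mono) auto
      finally have Y: "1 \<le> Y" .
      have log: "0 \<le> log 2 (real n)" using elim by simp
      have "real n = 2 powr (log 2 (real n))" using elim by simp
      also have "\<dots> \<le> 2 powr (real d)"
        unfolding d_def using log by (intro powr_mono) auto
      finally have d: "n \<le> 2 ^ d" by (simp add: powr_realpow)
      have "log 2 (real n) \<le> 3 / 2 * ln (real n)"
        using mult_left_mono[OF ln2_ge_two_thirds, of "ln (real n)"] ln
        by (simp add: log_def divide_le_eq)
      \<comment> \<open>Rounding up adds at most 1, and \<open>1 \<le> 3 / 2 * ln n\<close> because
        \<open>n \<ge> 2\<close>.\<close>
      then have "real d \<le> 3 * ln (real n)" unfolding d_def using log ln by linarith
      then have "real d * (20 * (\<rho> * real n)) \<le> 3 * ln (real n) * (20 * (\<rho> * real n))"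
        using \<rho> by (intro mult_right_mono) auto
      also have "\<dots> = 60 * Y" by (simp add: Y_def)
      also have "\<dots> \<le> real fuel" unfolding fuel_def by linarith
      finally have fuel: "real d * (20 * (\<rho> * real n)) \<le> real fuel" .
      have m: "10 ^ 5 * X \<le> real m" unfolding m_def by linarith
      have "uniformity_tester n E \<epsilon> \<rho> (1 / 3)
          (tester n d fuel m (\<rho>\<^sup>2 * \<epsilon>\<^sup>2 / (320 * real n)))"
        using * by (intro tester_correct[OF _ _ big d fuel m[unfolded X_def]]) auto
      moreover have "0 \<le> 10 ^ 5 * X" using X by simp
      then have "real m \<le> 10 ^ 5 * X + 1" unfolding m_def by linarith
      \<comment> \<open>As \<open>X\<close> and \<open>Y\<close> are at least 1, rounding is
        absorbed in the constants: 2 * (10^5 + 1) for the two batches, and 60 + 1 + 3 for the fuel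
        and the three initial queries.\<close>
      then have "real (m + (m + 0)) \<le> 200002 * X" using X by simp
      moreover have "real (Suc (Suc (Suc fuel))) \<le> 64 * Y" unfolding fuel_def using Y by linarith
      ultimately show "\<exists>a s q. uniformity_tester n E \<epsilon> \<rho> (1 / 3) a \<and> uses_at_most n s q a \<and>
          real s \<le> 200002 * (sqrt (real n) / (\<rho> * \<epsilon>\<^sup>2)) \<and>
          real q \<le> 64 * (\<rho> * real n * ln (real n))"
        using uses_at_most_tester[OF elim] unfolding X_def Y_def by blast
    qed
  qed
qed simp_all

end
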